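(* Let $\mu$ be a centered probability measure on $\mathbb{R}$, absolutely continuous with respect to the Lebesgue measure and supported on a compact interval, let $u$ be the free moment map of $\mu$, i.e. $\mu=(u')_{\sharp}\nu_u$ with $\nu_u$ the free Gibbs measure associated with $u$, and assume that $u$ is $\mathcal{C}^2$ and strictly convex on $\mathbb{R}$. Let $\eta$ be the standard semicircular distribution. Then $$W_2(\mu,\eta)^2\le \iint\left[\frac{x-y}{(u^* )'(x)-(u^* )'(y)}-1\right]^2d\mu(x)\,d\mu(y)=\iint\left[\frac{u'(x)-u'(y)}{x-y}-1\right]^2d\nu_u(x)\,d\nu_u(y).$$
   Context: Free Gibbs measure: for a convex function $u:\mathbb{R}\to\mathbb{R}$, the free Gibbs measure $\nu_u$ is the unique minimizer, over Borel probability measures $\rho$ on $\mathbb{R}$, of $-\iint\log|t-s|\,d\rho(t)\,d\rho(s)+\int u(s)\,d\rho(s)$. Free moment map: for a centered probability measure $\mu\neq\delta_0$ on $\mathbb{R}$ with finite second moment, the free moment map of $\mu$ is the convex lower semicontinuous function $u$ such that $\mu$ is the pushforward $(u')_\sharp\nu_u$ of the free Gibbs measure $\nu_u$ by $u'$. $u^*(y)=\sup_x\{xy-u(x)\}$ is the Legendre transform of $u$, and $(u^* )'=(u')^{-1}$. The standard semicircular distribution is $\eta(dx)=\frac1{2\pi}\sqrt{4-x^2}\,dx$ on $[-2,2]$. $W_2$ is the quadratic Kantorovich–Wasserstein distance between probability measures on $\mathbb{R}$. In the paper the right-most quantity is denoted $\|\mathscr{D}u-\mathrm{Id}\|_{H^1(\nu_u)}^2$,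 where $\|f\|^2_{H^1(\lambda)}=\iint\big(\frac{f(x)-f(y)}{x-y}\big)^2d\lambda(x)d\lambda(y)$. *)

theory Defs
  imports "HOL-Probability.Probability"
begin

definition borel_prob :: "real measure \<Rightarrow> bool" where
  "borel_prob \<rho> \<longleftrightarrow> prob_space \<rho> \<and> sets \<rho> = sets borel"

(* Extended integral: positive part minus negative part. e2ennreal truncates negative
   values to 0, and in ereal \<infinity> - \<infinity> = \<infinity>, so an undefined integral counts as +\<infinity>. *)
definition ext_integral :: "'a measure \<Rightarrow> ('a \<Rightarrow> ereal) \<Rightarrow> ereal" where
  "ext_integral M f =
     enn2ereal (\<integral>\<^sup>+x. e2ennreal (f x) \<partial>M) - enn2ereal (\<integral>\<^sup>+x. e2ennreal (- f x) \<partial>M)"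

(* -log |t - s|, with the value +\<infinity> on the diagonal (the library has ln 0 = 0). *)
definition log_kernel :: "real \<Rightarrow> real \<Rightarrow> ereal" where
  "log_kernel t s = (if t = s then \<infinity> else ereal (- ln \<bar>t - s\<bar>))"

(* A sum \<infinity> + (-\<infinity>) is again \<infinity>. If u grows at least linearly at both ends, the energy
   therefore equals the double integral of -log |t - s| + (u t + u s) / 2, whose integrand
   is bounded below. *)
definition gibbs_energy :: "(real \<Rightarrow> real) \<Rightarrow> real measure \<Rightarrow> ereal" where
  "gibbs_energy u \<rho> =
     ext_integral (\<rho> \<Otimes>\<^sub>M \<rho>) (\<lambda>(t, s). log_kernel t s) + ext_integral \<rho> (\<lambda>s. ereal (u s))"

(* \<nu> is a minimizer, and the only one. *)
definition free_gibbs_measure :: "(real \<Rightarrow> real) \<Rightarrow> real measure \<Rightarrow> bool" where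
  "free_gibbs_measure u \<nu> \<longleftrightarrow> (\<forall>\<rho>. is_arg_min (gibbs_energy u) borel_prob \<rho> \<longleftrightarrow> \<rho> = \<nu>)"

(* Lower semicontinuity is automatic for a finite convex function on the line. This is a
   relation because u is determined by \<mu> only up to translation and additive constants. *)
definition free_moment_map :: "real measure \<Rightarrow> (real \<Rightarrow> real) \<Rightarrow> bool" where
  "free_moment_map \<mu> u \<longleftrightarrow>
     convex_on UNIV u \<and> (\<exists>\<nu>. free_gibbs_measure u \<nu> \<and> \<mu> = distr \<nu> borel (deriv u))"

definition legendre :: "(real \<Rightarrow> real) \<Rightarrow> real \<Rightarrow> ereal" where
  "legendre u y = (SUP x. ereal (x * y - u x))"

(* Derivative of the Legendre transform; meaningful at interior points of its domain. *)
definition legendre_deriv :: "(real \<Rightarrow> real) \<Rightarrow> real \<Rightarrow> real" where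
  "legendre_deriv u = deriv (\<lambda>y. real_of_ereal (legendre u y))"

definition semicircular :: "real measure" where
  "semicircular = density lborel
     (\<lambda>x. ennreal (indicator {-2..2} x * (1 / (2 * pi)) * sqrt (4 - x\<^sup>2)))"

definition couplings :: "real measure \<Rightarrow> real measure \<Rightarrow> (real \<times> real) measure set" where
  "couplings \<mu> \<nu> = {\<pi>. prob_space \<pi> \<and> sets \<pi> = sets (borel \<Otimes>\<^sub>M borel) \<and>
                        distr \<pi> borel fst = \<mu> \<and> distr \<pi> borel snd = \<nu>}"

definition transport_cost :: "real measure \<Rightarrow> real measure \<Rightarrow> ennreal" where
  "transport_cost \<mu> \<nu> = (INF \<pi> \<in> couplings \<mu> \<nu>. \<integral>\<^sup>+(x, y). ennreal ((x - y)\<^sup>2) \<partial>\<pi>)"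

definition W2 :: "real measure \<Rightarrow> real measure \<Rightarrow> ennreal" where
  "W2 \<mu> \<nu> = (if transport_cost \<mu> \<nu> = \<infinity> then \<infinity>
             else ennreal (sqrt (enn2real (transport_cost \<mu> \<nu>))))"

definition centered :: "real measure \<Rightarrow> bool" where
  "centered \<mu> \<longleftrightarrow> integrable \<mu> (\<lambda>x. x) \<and> (\<integral>x. x \<partial>\<mu>) = 0"

definition C2_real :: "(real \<Rightarrow> real) \<Rightarrow> bool" where
  "C2_real u \<longleftrightarrow> u C1_differentiable_on UNIV \<and> deriv u C1_differentiable_on UNIV"

definition strictly_convex :: "(real \<Rightarrow> real) \<Rightarrow> bool" where
  "strictly_convex u \<longleftrightarrow>
     (\<forall>x y t. x \<noteq> y \<longrightarrow> 0 < t \<longrightarrow> t < 1 \<longrightarrow>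
        u ((1 - t) * x + t * y) < (1 - t) * u x + t * u y)"

end

theory Submission
  imports Defs
begin

text \<open>
Let X be distributed as \<nu> and S as the semicircular distribution, coupled monotonically through
their quantile functions, and put Y = u'(X), which is distributed as \<mu>. Over two independent
copies, distinguished by a prime, consider the difference quotients

  a = (Y - Y') / (X - X'),   s = (S - S') / (X - X'),   r = (Y - Y') / (S - S').

All three are nonnegative, and a = r s. The measure \<nu> minimizes the energy with potential u, and
moving X in the direction S - Y does not lower it; to first order this says
E Y^2 - E Y S \<le> E (a - s) (lemma gibbs_first_variation). The semicircular
distribution satisfies the integration by parts inequality E r \<le> E S Y (lemma
semicircular_stein_inequality). As E S^2 = 1, adding up gives

  E (Y - S)^2 \<le> E (a - s - r + 1) \<le> E (sqrt a - 1)^2 \<le> E (a - 1)^2,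

where the second step is s + r \<ge> 2 sqrt a (lemmas gibbs_monotone_coupling and slope_product_inequality).
The left side is the cost of a coupling of \<mu> and the semicircular distribution, and the right
side is the double integral over \<nu>. S need not be a smooth function of X,
nor Y of S, and this is why both ingredients are inequalities, obtained with Fatou's lemma.

The two double integrals agree by the change of variables y = u'(x), because the derivative of
the Legendre transform is a left inverse of u' (lemma legendre_deriv_deriv).
\<close>

section \<open>Pairs of independent copies\<close>

lemma (in prob_space) distr_pair_snd_self: "distr (M \<Otimes>\<^sub>M M) M snd = M"
proof -
  interpret P: pair_prob_space M M ..
  have "distr (M \<Otimes>\<^sub>M M) M snd = distr (distr (M \<Otimes>\<^sub>M M) (M \<Otimes>\<^sub>M M) (\<lambda>(x, y). (y, x))) M snd"
    by (subst P.distr_pair_swap) (rule refl)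
  also have "\<dots> = distr (M \<Otimes>\<^sub>M M) M (snd \<circ> (\<lambda>(x, y). (y, x)))"
    by (intro distr_distr) auto
  also have "snd \<circ> (\<lambda>(x :: 'a, y :: 'a). (y, x)) = fst" by auto
  also have "distr (M \<Otimes>\<^sub>M M) M fst = M" by (rule distr_pair_fst)
  finally show ?thesis .
qed

lemma (in prob_space) AE_pair_fst:
  assumes "AE x in M. P x" shows "AE p in M \<Otimes>\<^sub>M M. P (fst p)"
  by (rule AE_distrD[OF measurable_fst]) (unfold distr_pair_fst, rule assms)

lemma (in prob_space) AE_pair_snd:
  assumes "AE x in M. P x" shows "AE p in M \<Otimes>\<^sub>M M. P (snd p)"
  by (rule AE_distrD[OF measurable_snd]) (unfold distr_pair_snd_self, rule assms)

lemma (in prob_space) integrable_pair_fst: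
  fixes f :: "'a \<Rightarrow> real"
  assumes "integrable M f" shows "integrable (M \<Otimes>\<^sub>M M) (\<lambda>p. f (fst p))"
  by (rule integrable_distr[OF measurable_fst]) (unfold distr_pair_fst, rule assms)

lemma (in prob_space) integrable_pair_snd:
  fixes f :: "'a \<Rightarrow> real"
  assumes "integrable M f" shows "integrable (M \<Otimes>\<^sub>M M) (\<lambda>p. f (snd p))"
  by (rule integrable_distr[OF measurable_snd]) (unfold distr_pair_snd_self, rule assms)

section \<open>The semicircular distribution\<close>

text \<open>
The Chebyshev polynomials of the second kind, rescaled to [-2,2]. They are the orthonormal
polynomials of the semicircular distribution.
\<close>

fun chebU :: "nat \<Rightarrow> real \<Rightarrow> real" where
  "chebU 0 x = 1"
| "chebU (Suc 0) x = x"
| "chebU (Suc (Suc n)) x = x * chebU (Suc n) x - chebU n x"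

lemma chebU_cos: "chebU n (2 * cos \<phi>) * sin \<phi> = sin (real (Suc n) * \<phi>)"
proof (induction n "2 * cos \<phi>" rule: chebU.induct)
  case 2
  show ?case by (simp add: sin_double)
next
  case (3 n)
  have "sin (real (Suc (Suc (Suc n))) * \<phi>) + sin (real (Suc n) * \<phi>)
      = 2 * cos \<phi> * sin (real (Suc (Suc n)) * \<phi>)"
    using sin_add[of "real (Suc (Suc n)) * \<phi>" \<phi>] sin_diff[of "real (Suc (Suc n)) * \<phi>" \<phi>]
    by (simp add: algebra_simps)
  with 3 show ?case by (simp add: algebra_simps)
qed simp

text \<open>
Two consecutive values lie on the conic p^2 - x p q + q^2 = 1. For |x| at most 2 this forces
their absolute values to differ by at most 1, which gives linear growth in n.
\<close>

lemma chebU_bound: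
  assumes "\<bar>x\<bar> \<le> 2"
  shows "\<bar>chebU n x\<bar> \<le> real n + 1"
proof -
  have inv: "(chebU (Suc n) x)\<^sup>2 - x * chebU (Suc n) x * chebU n x + (chebU n x)\<^sup>2 = 1" for n
    by (induction n) (simp_all add: power2_eq_square algebra_simps)
  have step: "\<bar>chebU (Suc n) x\<bar> \<le> \<bar>chebU n x\<bar> + 1" for n
  proof -
    have "x * chebU (Suc n) x * chebU n x \<le> 2 * (\<bar>chebU (Suc n) x\<bar> * \<bar>chebU n x\<bar>)"
      using mult_right_mono[OF assms, of "\<bar>chebU (Suc n) x\<bar> * \<bar>chebU n x\<bar>"]
        abs_ge_self[of "x * chebU (Suc n) x * chebU n x"] by (simp add: abs_mult mult.assoc)
    then have "(\<bar>chebU (Suc n) x\<bar> - \<bar>chebU n x\<bar>)\<^sup>2 \<le> 1"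
      using inv[of n] by (simp add: power2_diff)
    then have "\<bar>\<bar>chebU (Suc n) x\<bar> - \<bar>chebU n x\<bar>\<bar> \<le> 1"
      by (simp add: abs_square_le_1)
    then show ?thesis by linarith
  qed
  show ?thesis
  proof (induction n)
    case (Suc n)
    with step[of n] show ?case by simp
  qed simp
qed

lemma continuous_on_chebU [continuous_intros]: "continuous_on A (chebU n)"
  by (induction n rule: induct_nat_012)
     (auto intro!: continuous_intros simp: chebU.simps[abs_def] fun_eq_iff cong: continuous_on_cong)

lemma borel_measurable_chebU [measurable]: "chebU n \<in> borel_measurable borel"
  by (intro borel_measurable_continuous_onI continuous_on_chebU)

definition semicircle_density :: "real \<Rightarrow> real" where
  "semicircle_density x = indicator {-2..2} x * (1 / (2 * pi)) * sqrt (4 - x\<^sup>2)"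

lemma semicircle_density_nonneg: "0 \<le> semicircle_density x"
proof (cases "x \<in> {-2..2}")
  case True
  then have "x\<^sup>2 \<le> 2\<^sup>2" by (intro abs_le_square_iff[THEN iffD1]) auto
  then show ?thesis by (simp add: semicircle_density_def)
qed (simp add: semicircle_density_def)

lemma borel_measurable_semicircle_density [measurable]:
  "semicircle_density \<in> borel_measurable borel"
  unfolding semicircle_density_def by measurable

lemma semicircular_eq: "semicircular = density lborel (\<lambda>x. ennreal (semicircle_density x))"
  by (simp add: semicircular_def semicircle_density_def)

lemma sets_semicircular [simp, measurable_cong]: "sets semicircular = sets borel"
  by (simp add: semicircular_eq)

lemma space_semicircular [simp]: "space semicircular = UNIV"
  by (simp add: semicircular_eq)

lemma integral_semicircular:
  fixes f :: "real \<Rightarrow> real"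
  assumes f: "continuous_on {-2..2} f" and [measurable]: "f \<in> borel_measurable borel"
    and I: "((\<lambda>x. sqrt (4 - x\<^sup>2) * f x) has_integral I) {-2..2}"
  shows "integrable semicircular f" "(\<integral>x. f x \<partial>semicircular) = I / (2 * pi)"
proof -
  let ?g = "\<lambda>x. sqrt (4 - x\<^sup>2) * f x"
  have int: "integrable lborel (\<lambda>x. indicator {-2..2} x *\<^sub>R ?g x)"
    by (intro borel_integrable_compact compact_Icc continuous_intros f)
  have eq: "semicircle_density x *\<^sub>R f x = (1 / (2 * pi)) * (indicator {-2..2} x *\<^sub>R ?g x)" for x
    by (simp add: semicircle_density_def)
  show "integrable semicircular f"
    unfolding semicircular_eq using integrable_mult_right[OF int, of "1 / (2 * pi)"]
    by (subst integrable_density) (auto simp: semicircle_density_nonneg eq simp del: real_scaleR_def)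
  have "(\<integral>x. f x \<partial>semicircular) = (\<integral>x. semicircle_density x *\<^sub>R f x \<partial>lborel)"
    unfolding semicircular_eq
    by (subst integral_density) (auto simp: semicircle_density_nonneg)
  also have "\<dots> = (1 / (2 * pi)) * (LINT x:{-2..2}|lborel. ?g x)"
    unfolding eq set_lebesgue_integral_def by (rule integral_mult_right_zero)
  also have "(LINT x:{-2..2}|lborel. ?g x) = I"
    using set_borel_integral_eq_integral(2)[of "{-2..2}" ?g] int I
    by (simp add: set_integrable_def integral_unique)
  finally show "(\<integral>x. f x \<partial>semicircular) = I / (2 * pi)" by simp
qed

text \<open>
With x = 2 cos \<phi> the integrand becomes a product of two sines, whose primitive is explicit.
The primitive is pulled back through arccos, so that it is continuous on [-2,2] although it is
differentiated only in the interior.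
\<close>

lemma chebU_has_integral:
  "((\<lambda>x. sqrt (4 - x\<^sup>2) * chebU n x) has_integral (if n = 0 then 2 * pi else 0)) {-2..2}"
proof -
  \<comment> \<open>Up to sign and a factor 2, the primitive in the angle. At n = 0 the first sine quotient
      degenerates to the angle itself, which produces the total mass.\<close>
  define A where "A \<phi> = (if n = 0 then \<phi> else sin (real n * \<phi>) / n)
      - sin (real (n + 2) * \<phi>) / (n + 2)" for \<phi> :: real
  have A: "(A has_real_derivative 2 * sin (real (Suc n) * \<phi>) * sin \<phi>) (at \<phi>)" for \<phi>
  proof -
    have S: "((\<lambda>\<phi>. sin (real k * \<phi>) / k) has_real_derivative cos (real k * \<phi>)) (at \<phi>)"
      if "k > 0" for k
      using that by (auto intro!: derivative_eq_intros simp del: of_nat_Suc)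
    have "((\<lambda>\<phi>. if n = 0 then \<phi> else sin (real n * \<phi>) / n)
        has_real_derivative cos (real n * \<phi>)) (at \<phi>)"
      using S[of n] by (cases "n = 0") auto
    then have "(A has_real_derivative cos (real n * \<phi>) - cos (real (n + 2) * \<phi>)) (at \<phi>)"
      unfolding A_def by (rule DERIV_diff) (rule S, simp)
    moreover have "cos (real n * \<phi>) - cos (real (n + 2) * \<phi>) = 2 * sin (real (Suc n) * \<phi>) * sin \<phi>"
      using cos_add[of "real (Suc n) * \<phi>" \<phi>] cos_diff[of "real (Suc n) * \<phi>" \<phi>]
      by (simp add: algebra_simps)
    ultimately show ?thesis by simp
  qed
  define F where "F x = - 2 * A (arccos (x / 2))" for x
  have "((\<lambda>x. sqrt (4 - x\<^sup>2) * chebU n x) has_integral (F 2 - F (-2))) {-2..2}"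
  proof (rule fundamental_theorem_of_calculus_interior)
    have "continuous_on UNIV A"
      by (intro continuous_at_imp_continuous_on ballI DERIV_isCont[OF A])
    moreover have "continuous_on {-2..2} (\<lambda>x. arccos (x / 2))"
      by (rule continuous_on_arccos) (auto intro!: continuous_intros)
    ultimately have "continuous_on {-2..2} (\<lambda>x. A (arccos (x / 2)))"
      by (rule continuous_on_compose2) simp
    then show "continuous_on {-2..2} F"
      unfolding F_def by (rule continuous_on_mult_left)
  next
    fix x :: real assume x: "x \<in> {-2<..<2}"
    define \<phi> where "\<phi> = arccos (x / 2)"
    have c: "x = 2 * cos \<phi>" using x by (simp add: \<phi>_def cos_arccos)
    have s: "sqrt (1 - (x / 2)\<^sup>2) = sin \<phi>" using x by (simp add: \<phi>_def sin_arccos)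
    have s4: "sqrt (4 - x\<^sup>2) = 2 * sin \<phi>"
    proof -
      have "sqrt (4 - x\<^sup>2) = sqrt (4 * (1 - (x / 2)\<^sup>2))" by (simp add: power_divide)
      also have "\<dots> = 2 * sqrt (1 - (x / 2)\<^sup>2)" by (subst real_sqrt_mult) simp
      finally show ?thesis using s by simp
    qed
    have "\<bar>x / 2\<bar> < 1" using x by auto
    then have "(x / 2)\<^sup>2 < 1" by (simp only: abs_square_less_1)
    then have sp: "sin \<phi> > 0" unfolding s[symmetric] by simp
    have "(F has_real_derivative - 2 * ((2 * sin (real (Suc n) * \<phi>) * sin \<phi>) * (inverse (- sqrt (1 - (x/2)\<^sup>2)) * (1/2)))) (at x)"
    proof -
      have "((\<lambda>x. x / 2) has_real_derivative 1 / 2) (at x)"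
        by (rule DERIV_cdivide[OF DERIV_ident])
      moreover have "DERIV arccos (x / 2) :> inverse (- sqrt (1 - (x/2)\<^sup>2))"
        using x by (intro DERIV_arccos) auto
      ultimately have "((\<lambda>x. arccos (x / 2)) has_real_derivative
          inverse (- sqrt (1 - (x/2)\<^sup>2)) * (1 / 2)) (at x)"
        by (rule DERIV_chain2[rotated])
      from DERIV_cmult[OF DERIV_chain2[OF A this]] show ?thesis
        unfolding F_def \<phi>_def .
    qed
    also have "- 2 * ((2 * sin (real (Suc n) * \<phi>) * sin \<phi>) * (inverse (- sqrt (1 - (x/2)\<^sup>2)) * (1/2)))
        = 2 * sin (real (Suc n) * \<phi>)"
      unfolding s using sp by (simp add: field_simps)
    also have "\<dots> = sqrt (4 - x\<^sup>2) * chebU n x"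
      unfolding s4 using chebU_cos[of n \<phi>] unfolding c by (simp add: mult.commute)
    finally show "(F has_vector_derivative sqrt (4 - x\<^sup>2) * chebU n x) (at x)"
      by (simp add: has_real_derivative_iff_has_vector_derivative)
  qed simp
  moreover have "F 2 - F (-2) = (if n = 0 then 2 * pi else 0)"
  proof -
    have "A pi = (if n = 0 then pi else 0)"
      unfolding A_def sin_npi by simp
    moreover have "A 0 = 0" by (simp add: A_def)
    ultimately show ?thesis by (simp add: F_def)
  qed
  ultimately show ?thesis by simp
qed

lemma integrable_chebU: "integrable semicircular (chebU n)"
  and integral_chebU: "(\<integral>y. chebU n y \<partial>semicircular) = (if n = 0 then 1 else 0)"
  using integral_semicircular[OF continuous_on_chebU borel_measurable_chebU chebU_has_integral, of n]
  by auto

lemma prob_space_semicircular: "prob_space semicircular"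
proof
  have "emeasure semicircular (space semicircular) = (\<integral>\<^sup>+ x. ennreal (chebU 0 x) \<partial>semicircular)"
    by (simp del: space_semicircular)
  also have "\<dots> = ennreal (\<integral>x. chebU 0 x \<partial>semicircular)"
    by (intro nn_integral_eq_integral integrable_chebU) auto
  finally show "emeasure semicircular (space semicircular) = 1"
    using integral_chebU[of 0] by simp
qed

lemma integral_id_chebU: "(\<integral>y. y * chebU n y \<partial>semicircular) = (if n = 1 then 1 else 0)"
proof -
  have eq: "y * chebU n y = chebU (Suc n) y + (if n = 0 then 0 else chebU (n - 1) y)" for y
    by (cases n) auto
  show ?thesis
    unfolding eq by (cases "n = 0") (auto simp: integrable_chebU integral_chebU simp del: chebU.simps)
qed

lemma AE_semicircular: "AE x in semicircular. x \<in> {-2..2}"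
  unfolding semicircular_eq
  by (subst AE_density) (auto simp: semicircle_density_def indicator_def)

lemma integral_square_semicircular: "(\<integral>x. x\<^sup>2 \<partial>semicircular) = 1"
  using integral_id_chebU[of 1] by (simp add: power2_eq_square)

text \<open>
The denominator of the Mehler kernel of the semicircular distribution: the sum of
r^n U_n(x) U_n(y) is (1 - r^2) / mehler r x y. At r = 1 it degenerates to (x - y)^2, so that
(x - y) / mehler r x y regularizes 1 / (x - y) by a kernel that keeps the sign of x - y.
\<close>

definition mehler :: "real \<Rightarrow> real \<Rightarrow> real \<Rightarrow> real" where
  "mehler r x y = (1 - r\<^sup>2)\<^sup>2 - r * (1 + r\<^sup>2) * x * y + r\<^sup>2 * (x\<^sup>2 + y\<^sup>2)"

lemma mehler_alt: "mehler r x y = r\<^sup>2 * (x - y)\<^sup>2 + (1 - r)\<^sup>2 * ((1 + r)\<^sup>2 - r * (x * y))"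
  by (simp add: mehler_def power2_eq_square algebra_simps)

lemma mehler_ge:
  assumes "\<bar>x\<bar> \<le> 2" "\<bar>y\<bar> \<le> 2" "0 \<le> r"
  shows "(1 - r)^4 \<le> mehler r x y"
proof -
  have "x * y \<le> 4"
    using mult_mono[OF assms(1,2)] abs_ge_self[of "x * y"] by (simp add: abs_mult)
  then have "r * (x * y) \<le> r * 4" using assms by (intro mult_left_mono)
  then have "(1 - r)\<^sup>2 \<le> (1 + r)\<^sup>2 - r * (x * y)" by (simp add: power2_eq_square algebra_simps)
  then have "(1 - r)\<^sup>2 * (1 - r)\<^sup>2 \<le> (1 - r)\<^sup>2 * ((1 + r)\<^sup>2 - r * (x * y))"
    by (intro mult_left_mono) auto
  also have "\<dots> \<le> mehler r x y" unfolding mehler_alt by simp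
  finally show ?thesis by (simp add: power2_eq_square power4_eq_xxxx mult.assoc)
qed

lemma summable_mehler:
  fixes r :: real
  assumes "0 \<le> r" "r < 1"
  shows "summable (\<lambda>n. r^n * ((real n + 1) * (real n + 1)))"
proof (rule summable_comparison_test)
  have 1: "summable (\<lambda>n. diffs (\<lambda>_. 1) n * x^n)" if "norm x < 1" for x :: real
    using that by (intro termdiff_converges[of x 1]) (auto intro: summable_geometric)
  show "summable (\<lambda>n. diffs (diffs (\<lambda>_. 1)) n * r^n)"
    using assms by (intro termdiff_converges[of r 1] 1) auto
  show "\<exists>N. \<forall>n\<ge>N. norm (r^n * ((real n + 1) * (real n + 1))) \<le> diffs (diffs (\<lambda>_. 1)) n * r^n"
    using assms by (auto simp: diffs_def abs_mult mult.commute[of "r^_"] intro!: mult_right_mono mult_mono)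
qed

text \<open>
The products U_n(x) U_n(y) satisfy a linear recurrence of order four, whose characteristic
polynomial is mehler r x y after reversal. Summing the recurrence determines the series.
\<close>

lemma mehler_sums:
  assumes x: "\<bar>x\<bar> \<le> 2" and y: "\<bar>y\<bar> \<le> 2" and r: "0 \<le> r" "r < 1"
  shows "(\<lambda>n. r^n * (chebU n x * chebU n y)) sums ((1 - r\<^sup>2) / mehler r x y)"
proof -
  define p where "p n = r^n * (chebU n x * chebU n y)" for n
  have bound: "norm (p n) \<le> r^n * ((real n + 1) * (real n + 1))" for n
    unfolding p_def using chebU_bound[OF x, of n] chebU_bound[OF y, of n] r
    by (auto simp: abs_mult intro!: mult_mono)
  have sm: "summable p"
    by (rule summable_comparison_test'[OF summable_mehler[OF r] bound])
  define S where "S = suminf p"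
  have p: "p sums S" unfolding S_def using sm by (rule summable_sums)
  have rec: "p (n + 4) = r * x * y * p (n + 3) - r\<^sup>2 * (x\<^sup>2 + y\<^sup>2 - 2) * p (n + 2)
      + r^3 * x * y * p (n + 1) - r^4 * p n" for n
    by (simp add: p_def numeral_eq_Suc algebra_simps)
  have sh: "(\<lambda>n. p (n + k)) sums (S - (\<Sum>i<k. p i))" for k
    using p by (subst sums_iff_shift) auto
  have "(\<lambda>n. p (n + 4)) sums (r * x * y * (S - (\<Sum>i<3. p i)) - r\<^sup>2 * (x\<^sup>2 + y\<^sup>2 - 2) * (S - (\<Sum>i<2. p i))
      + r^3 * x * y * (S - (\<Sum>i<1. p i)) - r^4 * S)"
    unfolding rec by (intro sums_add sums_diff sums_mult sh p)
  with sh[of 4] have "S - (\<Sum>i<4. p i) = r * x * y * (S - (\<Sum>i<3. p i)) - r\<^sup>2 * (x\<^sup>2 + y\<^sup>2 - 2) * (S - (\<Sum>i<2. p i))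
      + r^3 * x * y * (S - (\<Sum>i<1. p i)) - r^4 * S"
    by (rule sums_unique2)
  moreover have "S * mehler r x y - (1 - r\<^sup>2) = (S - (\<Sum>i<4. p i))
      - (r * x * y * (S - (\<Sum>i<3. p i)) - r\<^sup>2 * (x\<^sup>2 + y\<^sup>2 - 2) * (S - (\<Sum>i<2. p i))
        + r^3 * x * y * (S - (\<Sum>i<1. p i)) - r^4 * S)"
    by (simp add: p_def mehler_def numeral_eq_Suc lessThan_Suc algebra_simps)
  ultimately have "S * mehler r x y = 1 - r\<^sup>2" by simp
  moreover have "mehler r x y > 0"
    using mehler_ge[OF x y r(1)] r by (meson diff_gt_0_iff_gt less_le_trans zero_less_power)
  ultimately have "S = (1 - r\<^sup>2) / mehler r x y" by (simp add: field_simps)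
  with p show ?thesis unfolding p_def by simp
qed

lemma borel_measurable_mehler [measurable]:
  "mehler r x \<in> borel_measurable borel"
  unfolding mehler_def by measurable

lemma mehler_pos:
  assumes "\<bar>x\<bar> \<le> 2" "\<bar>y\<bar> \<le> 2" "0 \<le> r" "r < 1"
  shows "0 < mehler r x y"
  using mehler_ge[OF assms(1-3)] assms(4)
  by (meson diff_gt_0_iff_gt less_le_trans zero_less_power)

text \<open>
Orthogonality selects one term of the Mehler series: the constant one when the weight is 1, the
linear one when the weight is y. As r tends to 1 this becomes the singular integral equation
of the semicircular distribution: the principal value of the integral of 1 / (x - y) is x / 2
on [-2,2].
\<close>

lemma integral_mehler:
  assumes x: "\<bar>x\<bar> \<le> 2" and r: "0 \<le> r" "r < 1"
  shows "(\<integral>y. (x - y) / mehler r x y \<partial>semicircular) = x / (1 + r)"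
proof -
  interpret prob_space semicircular by (rule prob_space_semicircular)
  have AE: "AE y in semicircular. \<bar>y\<bar> \<le> 2"
    using AE_semicircular by eventually_elim auto
  define c where "c n = r^n * chebU n x" for n
  have cb: "\<bar>c n\<bar> \<le> r^n * (real n + 1)" for n
    unfolding c_def using chebU_bound[OF x, of n] r by (auto simp: abs_mult intro!: mult_mono)
  \<comment> \<open>Termwise integration against a bounded weight w; the instances are w = 1 and w = id.\<close>
  have *: "(\<lambda>n. c n * I n) sums (\<integral>y. w y * ((1 - r\<^sup>2) / mehler r x y) \<partial>semicircular)"
    if wm [measurable]: "w \<in> borel_measurable borel" and wb: "\<And>y. \<bar>y\<bar> \<le> 2 \<Longrightarrow> \<bar>w y\<bar> \<le> 4"
      and I: "\<And>n. I n = (\<integral>y. w y * chebU n y \<partial>semicircular)" for w I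
  proof -
    let ?f = "\<lambda>n y. c n * (w y * chebU n y)"
    let ?b = "\<lambda>n. 4 * (r^n * ((real n + 1) * (real n + 1)))"
    have fb: "norm (?f n y) \<le> ?b n" if "\<bar>y\<bar> \<le> 2" for n y
    proof -
      have "norm (?f n y) \<le> (r^n * (real n + 1)) * (4 * (real n + 1))"
        unfolding real_norm_def abs_mult
        using wb[OF that] chebU_bound[OF that, of n] cb[of n] r by (intro mult_mono) auto
      then show ?thesis by (simp add: algebra_simps)
    qed
    have sb: "summable ?b" by (intro summable_mult summable_mehler r)
    have fint: "integrable semicircular (?f n)" for n
      using AE fb by (intro integrable_const_bound[where B = "?b n"]) auto
    have "(\<lambda>n. \<integral>y. ?f n y \<partial>semicircular) sums (\<integral>y. (\<Sum>n. ?f n y) \<partial>semicircular)"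
    proof (rule sums_integral[OF fint])
      show "AE y in semicircular. summable (\<lambda>n. norm (?f n y))"
        using AE
      proof eventually_elim
        case (elim y)
        show ?case by (rule summable_comparison_test'[OF sb]) (use fb[OF elim] in auto)
      qed
      have "(\<integral>y. norm (?f n y) \<partial>semicircular) \<le> ?b n" for n
      proof -
        have "(\<integral>y. norm (?f n y) \<partial>semicircular) \<le> (\<integral>y. ?b n \<partial>semicircular)"
          using AE fb by (intro integral_mono_AE integrable_norm fint) auto
        then show ?thesis using prob_space by simp
      qed
      then show "summable (\<lambda>n. \<integral>y. norm (?f n y) \<partial>semicircular)"
        by (intro summable_comparison_test'[OF sb]) simp
    qed
    moreover have "(\<integral>y. ?f n y \<partial>semicircular) = c n * I n" for n
      unfolding I by simp
    moreover have "(\<integral>y. (\<Sum>n. ?f n y) \<partial>semicircular)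
        = (\<integral>y. w y * ((1 - r\<^sup>2) / mehler r x y) \<partial>semicircular)"
    proof (rule integral_cong_AE)
      show "AE y in semicircular. (\<Sum>n. ?f n y) = w y * ((1 - r\<^sup>2) / mehler r x y)"
        using AE
      proof eventually_elim
        case (elim y)
        have "(\<lambda>n. w y * (r^n * (chebU n x * chebU n y))) sums (w y * ((1 - r\<^sup>2) / mehler r x y))"
          by (intro sums_mult mehler_sums x elim r)
        from sums_unique[OF this] show ?case by (simp add: c_def algebra_simps)
      qed
    qed auto
    ultimately show ?thesis by (simp only:)
  qed
  have 1: "(\<integral>y. (1 - r\<^sup>2) / mehler r x y \<partial>semicircular) = 1"
  proof -
    have "(\<lambda>n. c n * (if n = 0 then 1 else 0)) sums (\<integral>y. 1 * ((1 - r\<^sup>2) / mehler r x y) \<partial>semicircular)"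
      by (rule *) (auto simp: integral_chebU)
    moreover have "(\<lambda>n. c n * (if n = 0 then 1 else 0)) sums c 0"
      using sums_single[of 0 c] by (simp add: if_distrib cong: if_cong)
    ultimately show ?thesis using sums_unique2 by (fastforce simp: c_def)
  qed
  have 2: "(\<integral>y. y * ((1 - r\<^sup>2) / mehler r x y) \<partial>semicircular) = r * x"
  proof -
    have "(\<lambda>n. c n * (if n = 1 then 1 else 0)) sums (\<integral>y. y * ((1 - r\<^sup>2) / mehler r x y) \<partial>semicircular)"
      by (rule *) (auto simp: integral_id_chebU)
    moreover have "(\<lambda>n. c n * (if n = 1 then 1 else 0)) sums c 1"
      using sums_single[of 1 c] by (simp add: if_distrib cong: if_cong)
    ultimately show ?thesis using sums_unique2 by (fastforce simp: c_def)
  qed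
  have r2: "1 - r\<^sup>2 = (1 - r) * (1 + r)" "1 - r > 0" "1 + r > 0"
    using r by (auto simp: power2_eq_square algebra_simps)
  have d: "1 - r\<^sup>2 \<noteq> 0" unfolding r2(1) using r2(2,3) by simp
  have bd: "\<bar>1 / mehler r x y\<bar> \<le> 1 / (1 - r)^4" if "\<bar>y\<bar> \<le> 2" for y
    using mehler_ge[OF x that r(1)] mehler_pos[OF x that r] r by (auto intro!: divide_left_mono)
  have i1: "integrable semicircular (\<lambda>y. 1 / mehler r x y)"
    using AE bd by (intro integrable_const_bound[where B = "1 / (1 - r)^4"]) auto
  have i2: "integrable semicircular (\<lambda>y. y * (1 / mehler r x y))"
  proof (rule integrable_const_bound[where B = "2 * (1 / (1 - r)^4)"])
    show "AE y in semicircular. norm (y * (1 / mehler r x y)) \<le> 2 * (1 / (1 - r)^4)"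
      using AE
    proof eventually_elim
      case (elim y)
      then show ?case using mult_mono[OF elim bd[OF elim]] by (simp add: abs_mult)
    qed
  qed auto
  have "(\<integral>y. (x - y) / mehler r x y \<partial>semicircular)
      = (\<integral>y. x * (1 / mehler r x y) - y * (1 / mehler r x y) \<partial>semicircular)"
    by (simp add: diff_divide_distrib)
  also have "\<dots> = x * (\<integral>y. 1 / mehler r x y \<partial>semicircular) - (\<integral>y. y * (1 / mehler r x y) \<partial>semicircular)"
    by (subst Bochner_Integration.integral_diff[OF integrable_mult_right[OF i1] i2])
      (simp only: integral_mult_right_zero)
  also have "(\<integral>y. 1 / mehler r x y \<partial>semicircular) = 1 / (1 - r\<^sup>2)"
  proof -
    have "(\<integral>y. 1 / mehler r x y \<partial>semicircular)
        = (\<integral>y. inverse (1 - r\<^sup>2) * ((1 - r\<^sup>2) / mehler r x y) \<partial>semicircular)"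
      using d by simp
    then show ?thesis by (simp only: integral_mult_right_zero 1) (simp add: inverse_eq_divide)
  qed
  also have "(\<integral>y. y * (1 / mehler r x y) \<partial>semicircular) = r * x / (1 - r\<^sup>2)"
  proof -
    have "(\<integral>y. y * (1 / mehler r x y) \<partial>semicircular)
        = (\<integral>y. inverse (1 - r\<^sup>2) * (y * ((1 - r\<^sup>2) / mehler r x y)) \<partial>semicircular)"
    proof (rule Bochner_Integration.integral_cong[OF refl])
      fix y
      have "inverse (1 - r\<^sup>2) * (y * ((1 - r\<^sup>2) / mehler r x y))
          = (inverse (1 - r\<^sup>2) * (1 - r\<^sup>2)) * (y * (1 / mehler r x y))" by simp
      then show "y * (1 / mehler r x y) = inverse (1 - r\<^sup>2) * (y * ((1 - r\<^sup>2) / mehler r x y))"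
        using left_inverse[OF d] by simp
    qed
    then show ?thesis by (simp only: integral_mult_right_zero 2) (simp add: inverse_eq_divide)
  qed
  also have "x * (1 / (1 - r\<^sup>2)) - r * x / (1 - r\<^sup>2) = x / (1 + r)"
  proof -
    have "x * (1 / (1 - r\<^sup>2)) - r * x / (1 - r\<^sup>2) = ((1 - r) * x) / (1 - r\<^sup>2)"
      by (simp add: diff_divide_distrib left_diff_distrib)
    also have "\<dots> = x / (1 + r)" unfolding r2(1) using r2(2) by simp
    finally show ?thesis .
  qed
  finally show ?thesis .
qed

text \<open>
Integration by parts for the semicircular distribution: if Y is a smooth function of S, the
expectation of S Y equals that of the difference quotient of Y along S over two independent
copies. For a merely comonotone Y the quotients are nonnegative, and Fatou's lemma still gives
one inequality: with the Mehler kernel instead of 1 / (S - S') the double integral is explicit,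
by antisymmetry of the kernel in the two copies.
\<close>

lemma semicircular_stein_inequality:
  fixes S Y :: "'a \<Rightarrow> real"
  assumes M: "prob_space M" and S [measurable]: "S \<in> borel_measurable M"
    and law: "distr M borel S = semicircular"
    and Y [measurable]: "Y \<in> borel_measurable M"
    and S2: "\<And>\<omega>. \<omega> \<in> space M \<Longrightarrow> \<bar>S \<omega>\<bar> \<le> 2"
    and YB: "AE \<omega> in M. \<bar>Y \<omega>\<bar> \<le> B"
    and co: "\<And>\<omega> \<omega>'. \<omega> \<in> space M \<Longrightarrow> \<omega>' \<in> space M \<Longrightarrow> 0 \<le> (Y \<omega> - Y \<omega>') * (S \<omega> - S \<omega>')"
  defines "\<rho> \<equiv> \<lambda>p. (Y (fst p) - Y (snd p)) / (S (fst p) - S (snd p))"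
  shows "integrable (M \<Otimes>\<^sub>M M) \<rho>" "(\<integral>p. \<rho> p \<partial>(M \<Otimes>\<^sub>M M)) \<le> (\<integral>\<omega>. S \<omega> * Y \<omega> \<partial>M)"
proof -
  interpret prob_space M by (rule M)
  interpret P: pair_prob_space M M ..
  define k where "k r p = (S (fst p) - S (snd p)) / mehler r (S (fst p)) (S (snd p))" for r p
  define K where "K r p = (Y (fst p) - Y (snd p)) * k r p" for r p
  have km [measurable]: "k r \<in> borel_measurable (M \<Otimes>\<^sub>M M)" for r
    unfolding k_def mehler_def by measurable
  have B0: "0 \<le> B"
    using eventually_happens'[OF ae_filter_bot YB] by auto
  note YB1 = AE_pair_fst[OF YB] and YB2 = AE_pair_snd[OF YB]
  have main: "(\<integral>\<^sup>+p. ennreal (K r p) \<partial>(M \<Otimes>\<^sub>M M)) = ennreal (2 / (1 + r) * (\<integral>\<omega>. S \<omega> * Y \<omega> \<partial>M))"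
      "0 \<le> (\<integral>\<omega>. S \<omega> * Y \<omega> \<partial>M)"
    if r: "0 \<le> r" "r < 1" for r
  proof -
    define D where "D = 4 / (1 - r)^4"
    have kb: "\<bar>k r p\<bar> \<le> D" if "p \<in> space (M \<Otimes>\<^sub>M M)" for p
    proof -
      have s: "\<bar>S (fst p)\<bar> \<le> 2" "\<bar>S (snd p)\<bar> \<le> 2"
        using that S2 by (auto simp: space_pair_measure)
      then show ?thesis
        unfolding k_def D_def abs_divide
        using mehler_ge[OF s r(1)] mehler_pos[OF s r] r by (intro frac_le) auto
    qed
    have i1: "integrable (M \<Otimes>\<^sub>M M) (\<lambda>p. Y (fst p) * k r p)"
    proof (rule P.integrable_const_bound[where B = "B * D"])
      show "AE p in M \<Otimes>\<^sub>M M. norm (Y (fst p) * k r p) \<le> B * D"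
        using YB1 AE_space by eventually_elim (auto simp: abs_mult intro!: mult_mono kb B0)
    qed simp
    have i2: "integrable (M \<Otimes>\<^sub>M M) (\<lambda>p. Y (snd p) * k r p)"
    proof (rule P.integrable_const_bound[where B = "B * D"])
      show "AE p in M \<Otimes>\<^sub>M M. norm (Y (snd p) * k r p) \<le> B * D"
        using YB2 AE_space by eventually_elim (auto simp: abs_mult intro!: mult_mono kb B0)
    qed simp
    have inner: "(\<integral>\<omega>'. k r (\<omega>, \<omega>') \<partial>M) = S \<omega> / (1 + r)" if "\<omega> \<in> space M" for \<omega>
    proof -
      have "(\<integral>\<omega>'. k r (\<omega>, \<omega>') \<partial>M) = (\<integral>y. (S \<omega> - y) / mehler r (S \<omega>) y \<partial>semicircular)"
        unfolding law[symmetric] by (subst integral_distr) (auto simp: k_def)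
      then show ?thesis using integral_mehler[OF S2[OF that] r] by simp
    qed
    have anti: "k r (\<omega>', \<omega>) = - k r (\<omega>, \<omega>')" for \<omega> \<omega>'
      by (simp add: k_def mehler_def algebra_simps minus_divide_left)
    have inner': "(\<integral>\<omega>'. k r (\<omega>', \<omega>) \<partial>M) = - (S \<omega> / (1 + r))" if "\<omega> \<in> space M" for \<omega>
    proof -
      have "(\<integral>\<omega>'. k r (\<omega>', \<omega>) \<partial>M) = (\<integral>\<omega>'. - k r (\<omega>, \<omega>') \<partial>M)"
        by (intro Bochner_Integration.integral_cong refl anti)
      then show ?thesis using inner[OF that] by simp
    qed
    have e1: "(\<integral>p. Y (fst p) * k r p \<partial>(M \<Otimes>\<^sub>M M)) = (\<integral>\<omega>. S \<omega> * Y \<omega> \<partial>M) / (1 + r)"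
    proof -
      have "(\<integral>p. Y (fst p) * k r p \<partial>(M \<Otimes>\<^sub>M M)) = (\<integral>\<omega>. (\<integral>\<omega>'. Y \<omega> * k r (\<omega>, \<omega>') \<partial>M) \<partial>M)"
        using P.integral_fst'[OF i1] by simp
      also have "\<dots> = (\<integral>\<omega>. (S \<omega> * Y \<omega>) / (1 + r) \<partial>M)"
        by (intro Bochner_Integration.integral_cong) (auto simp: inner)
      finally show ?thesis by simp
    qed
    have e2: "(\<integral>p. Y (snd p) * k r p \<partial>(M \<Otimes>\<^sub>M M)) = - (\<integral>\<omega>. S \<omega> * Y \<omega> \<partial>M) / (1 + r)"
    proof -
      have i2': "integrable (M \<Otimes>\<^sub>M M) (\<lambda>(\<omega>', \<omega>). Y \<omega> * k r (\<omega>', \<omega>))"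
        using i2 by (simp add: case_prod_beta')
      have "(\<integral>p. Y (snd p) * k r p \<partial>(M \<Otimes>\<^sub>M M)) = (\<integral>\<omega>. (\<integral>\<omega>'. Y \<omega> * k r (\<omega>', \<omega>) \<partial>M) \<partial>M)"
        using P.integral_snd[OF i2'] by (simp add: case_prod_beta')
      also have "\<dots> = (\<integral>\<omega>. - ((S \<omega> * Y \<omega>) / (1 + r)) \<partial>M)"
        by (intro Bochner_Integration.integral_cong) (auto simp: inner')
      finally show ?thesis by simp
    qed
    have K: "K r = (\<lambda>p. Y (fst p) * k r p - Y (snd p) * k r p)"
      by (auto simp: K_def algebra_simps)
    have Ki: "integrable (M \<Otimes>\<^sub>M M) (K r)"
      unfolding K by (intro Bochner_Integration.integrable_diff i1 i2)
    have K0: "AE p in M \<Otimes>\<^sub>M M. 0 \<le> K r p"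
    proof (rule AE_I2)
      fix p assume p: "p \<in> space (M \<Otimes>\<^sub>M M)"
      then show "0 \<le> K r p"
        using co[of "fst p" "snd p"] mehler_pos[OF S2 S2 r, of "fst p" "snd p"]
        by (auto simp: K_def k_def space_pair_measure)
    qed
    have e: "(\<integral>p. K r p \<partial>(M \<Otimes>\<^sub>M M)) = 2 / (1 + r) * (\<integral>\<omega>. S \<omega> * Y \<omega> \<partial>M)"
      unfolding K by (subst Bochner_Integration.integral_diff[OF i1 i2]) (simp add: e1 e2)
    show "(\<integral>\<^sup>+p. ennreal (K r p) \<partial>(M \<Otimes>\<^sub>M M)) = ennreal (2 / (1 + r) * (\<integral>\<omega>. S \<omega> * Y \<omega> \<partial>M))"
      unfolding e[symmetric] by (rule nn_integral_eq_integral[OF Ki K0])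
    show "0 \<le> (\<integral>\<omega>. S \<omega> * Y \<omega> \<partial>M)"
      using integral_nonneg_AE[OF K0] r unfolding e by (simp add: zero_le_divide_iff)
  qed
  \<comment> \<open>Where S and S' coincide, both the regularized and the limiting quotient are 0.\<close>
  define r where "r n = 1 - inverse (real (Suc n))" for n
  have r: "0 \<le> r n" "r n < 1" for n by (auto simp: r_def inverse_le_1_iff)
  have rlim: "r \<longlonglongrightarrow> 1"
    using tendsto_diff[OF tendsto_const[of 1] LIMSEQ_inverse_real_of_nat] by (simp add: r_def[abs_def])
  have lim: "(\<lambda>n. K (r n) p) \<longlonglongrightarrow> \<rho> p" for p
  proof (cases "S (fst p) = S (snd p)")
    case False
    have "(\<lambda>n. mehler (r n) (S (fst p)) (S (snd p))) \<longlonglongrightarrow> mehler 1 (S (fst p)) (S (snd p))"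
      unfolding mehler_def by (intro tendsto_intros rlim)
    also have "mehler 1 (S (fst p)) (S (snd p)) = (S (fst p) - S (snd p))\<^sup>2"
      by (simp add: mehler_alt)
    finally have "(\<lambda>n. K (r n) p) \<longlonglongrightarrow>
        (Y (fst p) - Y (snd p)) * ((S (fst p) - S (snd p)) / (S (fst p) - S (snd p))\<^sup>2)"
      unfolding K_def k_def using False by (intro tendsto_intros) auto
    then show ?thesis using False by (simp add: power2_eq_square \<rho>_def)
  qed (simp add: K_def k_def \<rho>_def)
  have lim2: "(\<lambda>n. ennreal (2 / (1 + r n) * (\<integral>\<omega>. S \<omega> * Y \<omega> \<partial>M)))
      \<longlonglongrightarrow> ennreal (2 / (1 + 1) * (\<integral>\<omega>. S \<omega> * Y \<omega> \<partial>M))"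
    by (intro tendsto_ennrealI tendsto_intros rlim) auto
  have "(\<integral>\<^sup>+p. ennreal (\<rho> p) \<partial>(M \<Otimes>\<^sub>M M))
      = (\<integral>\<^sup>+p. liminf (\<lambda>n. ennreal (K (r n) p)) \<partial>(M \<Otimes>\<^sub>M M))"
    by (intro nn_integral_cong lim_imp_Liminf[symmetric] tendsto_ennrealI lim) auto
  also have "\<dots> \<le> liminf (\<lambda>n. \<integral>\<^sup>+p. ennreal (K (r n) p) \<partial>(M \<Otimes>\<^sub>M M))"
    by (intro nn_integral_liminf) (simp add: K_def)
  also have "\<dots> = ennreal (2 / (1 + 1) * (\<integral>\<omega>. S \<omega> * Y \<omega> \<partial>M))"
    unfolding main(1)[OF r] by (intro lim_imp_Liminf lim2) auto
  finally have fatou: "(\<integral>\<^sup>+p. ennreal (\<rho> p) \<partial>(M \<Otimes>\<^sub>M M)) \<le> ennreal (\<integral>\<omega>. S \<omega> * Y \<omega> \<partial>M)"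
    by simp
  have \<rho>0: "AE p in M \<Otimes>\<^sub>M M. 0 \<le> \<rho> p"
  proof (rule AE_I2)
    fix p assume "p \<in> space (M \<Otimes>\<^sub>M M)"
    then have "0 \<le> (Y (fst p) - Y (snd p)) * (S (fst p) - S (snd p))"
      by (intro co) (auto simp: space_pair_measure)
    then show "0 \<le> \<rho> p"
      unfolding \<rho>_def zero_le_divide_iff zero_le_mult_iff by blast
  qed
  have [measurable]: "\<rho> \<in> borel_measurable (M \<Otimes>\<^sub>M M)" unfolding \<rho>_def by measurable
  show \<rho>i: "integrable (M \<Otimes>\<^sub>M M) \<rho>"
    using \<rho>0 fatou by (intro integrableI_nonneg) (auto simp: le_less_trans)
  show "(\<integral>p. \<rho> p \<partial>(M \<Otimes>\<^sub>M M)) \<le> (\<integral>\<omega>. S \<omega> * Y \<omega> \<partial>M)"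
    using fatou main(2)[of 0] unfolding nn_integral_eq_integral[OF \<rho>i \<rho>0]
    by (simp add: ennreal_le_iff)
qed

section \<open>First variation of the logarithmic energy\<close>

lemma borel_measurable_log_kernel [measurable]:
  "(\<lambda>p. log_kernel (fst p) (snd p)) \<in> borel_measurable (borel \<Otimes>\<^sub>M borel)"
  unfolding log_kernel_def by measurable

lemma ext_integral_eq_integral:
  fixes f :: "'a \<Rightarrow> ereal" and g :: "'a \<Rightarrow> real"
  assumes g: "integrable M g" and eq: "AE x in M. f x = ereal (g x)"
  shows "ext_integral M f = ereal (\<integral>x. g x \<partial>M)"
proof -
  have fin: "(\<integral>\<^sup>+x. ennreal (g x) \<partial>M) < \<infinity>" "(\<integral>\<^sup>+x. ennreal (- g x) \<partial>M) < \<infinity>"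
    using g by (auto simp: real_integrable_def top.not_eq_extremum)
  have 1: "(\<integral>\<^sup>+x. e2ennreal (f x) \<partial>M) = (\<integral>\<^sup>+x. ennreal (g x) \<partial>M)"
    using eq by (intro nn_integral_cong_AE) (auto elim!: eventually_mono)
  have 2: "(\<integral>\<^sup>+x. e2ennreal (- f x) \<partial>M) = (\<integral>\<^sup>+x. ennreal (- g x) \<partial>M)"
    using eq by (intro nn_integral_cong_AE) (auto elim!: eventually_mono)
  obtain a where a: "0 \<le> a" "(\<integral>\<^sup>+x. ennreal (g x) \<partial>M) = ennreal a"
    using fin(1) by (cases "\<integral>\<^sup>+x. ennreal (g x) \<partial>M") auto
  obtain b where b: "0 \<le> b" "(\<integral>\<^sup>+x. ennreal (- g x) \<partial>M) = ennreal b"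
    using fin(2) by (cases "\<integral>\<^sup>+x. ennreal (- g x) \<partial>M") auto
  show ?thesis
    unfolding ext_integral_def 1 2 real_lebesgue_integral_def[OF g] a b
    using a(1) b(1) by simp
qed

lemma gibbs_energy_distr:
  fixes Z :: "'a \<Rightarrow> real"
  assumes "prob_space M" and Z [measurable]: "Z \<in> borel_measurable M"
    and um [measurable]: "u \<in> borel_measurable borel"
    and ui: "integrable M (\<lambda>\<omega>. u (Z \<omega>))"
    and li: "integrable (M \<Otimes>\<^sub>M M) (\<lambda>p. ln \<bar>Z (fst p) - Z (snd p)\<bar>)"
    and ne: "AE p in M \<Otimes>\<^sub>M M. Z (fst p) \<noteq> Z (snd p)"
  shows "gibbs_energy u (distr M borel Z)
    = ereal ((\<integral>\<omega>. u (Z \<omega>) \<partial>M) - (\<integral>p. ln \<bar>Z (fst p) - Z (snd p)\<bar> \<partial>(M \<Otimes>\<^sub>M M)))"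
proof -
  interpret prob_space M by fact
  interpret D: prob_space "distr M borel Z" by (rule prob_space_distr) fact
  let ?D = "distr M borel Z"
  have pair: "?D \<Otimes>\<^sub>M ?D = distr (M \<Otimes>\<^sub>M M) (borel \<Otimes>\<^sub>M borel) (\<lambda>(x, y). (Z x, Z y))"
    by (intro pair_measure_distr Z D.sigma_finite_measure_axioms)
  have zz: "(\<lambda>(x, y). (Z x, Z y)) \<in> measurable (M \<Otimes>\<^sub>M M) (borel \<Otimes>\<^sub>M borel)"
    by measurable
  have "ext_integral (?D \<Otimes>\<^sub>M ?D) (\<lambda>(t, s). log_kernel t s)
      = ereal (\<integral>q. - ln \<bar>fst q - snd q\<bar> \<partial>(?D \<Otimes>\<^sub>M ?D))"
  proof (rule ext_integral_eq_integral)
    show "integrable (?D \<Otimes>\<^sub>M ?D) (\<lambda>q. - ln \<bar>fst q - snd q\<bar>)"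
      unfolding pair by (subst integrable_distr_eq[OF zz]) (use li in \<open>auto simp: case_prod_beta'\<close>)
    show "AE q in ?D \<Otimes>\<^sub>M ?D. (case q of (t, s) \<Rightarrow> log_kernel t s) = ereal (- ln \<bar>fst q - snd q\<bar>)"
      unfolding pair
    proof (subst AE_distr_iff[OF zz])
      show "AE p in M \<Otimes>\<^sub>M M. (case (case p of (x, y) \<Rightarrow> (Z x, Z y)) of (t, s) \<Rightarrow> log_kernel t s)
          = ereal (- ln \<bar>fst (case p of (x, y) \<Rightarrow> (Z x, Z y)) - snd (case p of (x, y) \<Rightarrow> (Z x, Z y))\<bar>)"
        using ne by eventually_elim (auto simp: log_kernel_def case_prod_beta')
    qed (simp add: case_prod_beta')
  qed
  also have "(\<integral>q. - ln \<bar>fst q - snd q\<bar> \<partial>(?D \<Otimes>\<^sub>M ?D)) = - (\<integral>p. ln \<bar>Z (fst p) - Z (snd p)\<bar> \<partial>(M \<Otimes>\<^sub>M M))"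
    unfolding pair by (subst integral_distr[OF zz]) (auto simp: case_prod_beta')
  finally have 1: "ext_integral (?D \<Otimes>\<^sub>M ?D) (\<lambda>(t, s). log_kernel t s)
      = ereal (- (\<integral>p. ln \<bar>Z (fst p) - Z (snd p)\<bar> \<partial>(M \<Otimes>\<^sub>M M)))" .
  have "ext_integral ?D (\<lambda>s. ereal (u s)) = ereal (\<integral>s. u s \<partial>?D)"
    by (rule ext_integral_eq_integral) (auto simp: integrable_distr_eq ui)
  also have "(\<integral>s. u s \<partial>?D) = (\<integral>\<omega>. u (Z \<omega>) \<partial>M)"
    by (rule integral_distr) auto
  finally have 2: "ext_integral ?D (\<lambda>s. ereal (u s)) = ereal (\<integral>\<omega>. u (Z \<omega>) \<partial>M)" .
  show ?thesis unfolding gibbs_energy_def 1 2 by simp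
qed

text \<open>If the minimal energy were infinite, every probability measure would be a minimizer, and none the only one.\<close>

lemma free_gibbs_measure_energy_less_top:
  assumes "free_gibbs_measure u \<nu>"
  shows "gibbs_energy u \<nu> < \<infinity>"
proof (rule ccontr)
  assume "\<not> ?thesis"
  then have top: "gibbs_energy u \<nu> = \<infinity>" by auto
  have min: "is_arg_min (gibbs_energy u) borel_prob \<nu>"
    using assms by (simp add: free_gibbs_measure_def)
  have "return borel x = \<nu>" for x
  proof -
    have "is_arg_min (gibbs_energy u) borel_prob (return borel x)"
      using min by (auto simp: is_arg_min_def top borel_prob_def prob_space_return less_le)
    then show ?thesis using assms by (simp add: free_gibbs_measure_def)
  qed
  from this[of 0] this[of 1] have "return borel (0::real) = return borel 1" by simp
  then have "emeasure (return borel (0::real)) {0} = emeasure (return borel (1::real)) {0}"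
    by (rule arg_cong)
  then show False by (simp add: emeasure_return)
qed

text \<open>
The energy adds two extended integrals, and an undefined one counts as \<infinity>, so finiteness
from above bounds both the positive part of the logarithmic kernel and that of u. The linear
growth of u then makes X integrable, which controls the remaining part of the kernel, since
ln |X - X'| is at most |X| + |X'|.
\<close>

lemma gibbs_energy_finite_imp:
  fixes X :: "'a \<Rightarrow> real"
  assumes "prob_space M" and X [measurable]: "X \<in> borel_measurable M"
    and um [measurable]: "u \<in> borel_measurable borel"
    and c: "0 < c" and growth: "\<And>x. c * \<bar>x\<bar> - C \<le> u x"
    and fin: "gibbs_energy u (distr M borel X) < \<infinity>"
  shows "integrable M (\<lambda>\<omega>. u (X \<omega>))" and "integrable M X"
    and "AE p in M \<Otimes>\<^sub>M M. X (fst p) \<noteq> X (snd p)"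
    and "integrable (M \<Otimes>\<^sub>M M) (\<lambda>p. ln \<bar>X (fst p) - X (snd p)\<bar>)"
proof -
  interpret prob_space M by fact
  interpret P: pair_prob_space M M ..
  interpret D: prob_space "distr M borel X" by (rule prob_space_distr) fact
  let ?D = "distr M borel X"
  have pair: "?D \<Otimes>\<^sub>M ?D = distr (M \<Otimes>\<^sub>M M) (borel \<Otimes>\<^sub>M borel) (\<lambda>(x, y). (X x, X y))"
    by (intro pair_measure_distr X D.sigma_finite_measure_axioms)
  have xx: "(\<lambda>(x, y). (X x, X y)) \<in> measurable (M \<Otimes>\<^sub>M M) (borel \<Otimes>\<^sub>M borel)"
    by measurable
  define L where "L = ext_integral (?D \<Otimes>\<^sub>M ?D) (\<lambda>(t, s). log_kernel t s)"
  define U where "U = ext_integral ?D (\<lambda>s. ereal (u s))"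
  have LU: "L \<noteq> \<infinity>" "U \<noteq> \<infinity>"
    using fin by (auto simp: gibbs_energy_def L_def U_def)
  have neg: "(\<integral>\<^sup>+\<omega>. ennreal (- u (X \<omega>)) \<partial>M) \<noteq> \<infinity>"
  proof -
    have "- u x \<le> \<bar>C\<bar>" for x
      using growth[of x] c mult_nonneg_nonneg[of c "\<bar>x\<bar>"] by linarith
    then have "(\<integral>\<^sup>+\<omega>. ennreal (- u (X \<omega>)) \<partial>M) \<le> (\<integral>\<^sup>+\<omega>. ennreal \<bar>C\<bar> \<partial>M)"
      by (intro nn_integral_mono ennreal_leI)
    then show ?thesis by (auto simp: emeasure_space_1 top_unique)
  qed
  have "(\<integral>\<^sup>+\<omega>. ennreal (u (X \<omega>)) \<partial>M) \<noteq> \<infinity>"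
  proof
    assume "(\<integral>\<^sup>+\<omega>. ennreal (u (X \<omega>)) \<partial>M) = \<infinity>"
    then have "U = \<infinity>"
      unfolding U_def ext_integral_def by (simp add: nn_integral_distr)
    with LU show False by simp
  qed
  with neg show ui: "integrable M (\<lambda>\<omega>. u (X \<omega>))"
    by (simp add: real_integrable_def)
  show Xi: "integrable M X"
  proof (rule Bochner_Integration.integrable_bound)
    show "integrable M (\<lambda>\<omega>. (u (X \<omega>) + C) / c)" using ui by simp
    have "\<bar>x\<bar> \<le> (u x + C) / c" for x
      using growth[of x] c by (simp add: field_simps)
    then show "AE \<omega> in M. norm (X \<omega>) \<le> norm ((u (X \<omega>) + C) / c)"
      unfolding real_norm_def by (intro AE_I2 order_trans[OF _ abs_ge_self])
  qed fact
  let ?k = "\<lambda>p. log_kernel (X (fst p)) (X (snd p))"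
  have km [measurable]: "?k \<in> borel_measurable (M \<Otimes>\<^sub>M M)"
    using measurable_comp[OF xx borel_measurable_log_kernel] by (simp add: comp_def case_prod_beta')
  have Ak: "(\<integral>\<^sup>+p. e2ennreal (?k p) \<partial>(M \<Otimes>\<^sub>M M)) \<noteq> \<infinity>"
  proof
    assume *: "(\<integral>\<^sup>+p. e2ennreal (?k p) \<partial>(M \<Otimes>\<^sub>M M)) = \<infinity>"
    have "(\<integral>\<^sup>+q. e2ennreal (case q of (t, s) \<Rightarrow> log_kernel t s) \<partial>(?D \<Otimes>\<^sub>M ?D))
        = (\<integral>\<^sup>+p. e2ennreal (?k p) \<partial>(M \<Otimes>\<^sub>M M))"
      unfolding pair by (subst nn_integral_distr[OF xx]) (auto simp: case_prod_beta')
    with * have "L = \<infinity>" unfolding L_def ext_integral_def by simp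
    with LU show False by simp
  qed
  then have "AE p in M \<Otimes>\<^sub>M M. e2ennreal (?k p) \<noteq> \<infinity>"
    by (intro nn_integral_PInf_AE) auto
  then show ne: "AE p in M \<Otimes>\<^sub>M M. X (fst p) \<noteq> X (snd p)"
    by eventually_elim (auto simp: log_kernel_def)
  have "(\<integral>\<^sup>+p. ennreal (- ln \<bar>X (fst p) - X (snd p)\<bar>) \<partial>(M \<Otimes>\<^sub>M M)) = (\<integral>\<^sup>+p. e2ennreal (?k p) \<partial>(M \<Otimes>\<^sub>M M))"
    using ne by (intro nn_integral_cong_AE) (auto elim!: eventually_mono simp: log_kernel_def)
  with Ak have 1: "(\<integral>\<^sup>+p. ennreal (- ln \<bar>X (fst p) - X (snd p)\<bar>) \<partial>(M \<Otimes>\<^sub>M M)) \<noteq> \<infinity>" by simp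
  have i1: "integrable (M \<Otimes>\<^sub>M M) (\<lambda>p. X (fst p))" and i2: "integrable (M \<Otimes>\<^sub>M M) (\<lambda>p. X (snd p))"
    by (intro integrable_pair_fst integrable_pair_snd Xi)+
  have "(\<integral>\<^sup>+p. ennreal (ln \<bar>X (fst p) - X (snd p)\<bar>) \<partial>(M \<Otimes>\<^sub>M M))
      \<le> (\<integral>\<^sup>+p. ennreal (norm (X (fst p) - X (snd p))) \<partial>(M \<Otimes>\<^sub>M M))"
  proof (intro nn_integral_mono ennreal_leI)
    fix p
    show "ln \<bar>X (fst p) - X (snd p)\<bar> \<le> norm (X (fst p) - X (snd p))"
      using ln_le_minus_one[of "\<bar>X (fst p) - X (snd p)\<bar>"] by (cases "X (fst p) = X (snd p)") auto
  qed
  also have "\<dots> < \<infinity>"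
    using Bochner_Integration.integrable_diff[OF i1 i2] by (simp add: integrable_iff_bounded)
  finally show "integrable (M \<Otimes>\<^sub>M M) (\<lambda>p. ln \<bar>X (fst p) - X (snd p)\<bar>)"
    using 1 by (simp add: real_integrable_def)
qed

lemma ln_one_plus_ge:
  fixes x b :: real
  assumes "- b \<le> x" "0 \<le> b" "b \<le> 1 / 2"
  shows "- 2 * b \<le> ln (1 + x)"
proof -
  have "b\<^sup>2 \<le> b * (1 / 2)"
    unfolding power2_eq_square using assms by (intro mult_left_mono)
  then have "- 2 * b \<le> - b - 2 * b\<^sup>2" by simp
  also have "\<dots> \<le> ln (1 - b)" using assms by (intro ln_one_minus_pos_lower_bound) auto
  also have "\<dots> \<le> ln (1 + x)" using assms by simp
  finally show ?thesis .
qed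

lemma difference_quotient_tendsto:
  fixes f :: "real \<Rightarrow> real"
  assumes f: "(f has_real_derivative D) (at x)" and e: "e \<longlonglongrightarrow> 0" "\<And>n. e n \<noteq> 0"
  shows "(\<lambda>n. (f (x + e n * h) - f x) / e n) \<longlonglongrightarrow> D * h"
proof -
  have "((\<lambda>t. f (x + t * h)) has_real_derivative D * h) (at 0)"
    by (rule DERIV_chain2[where f = f]) (use f in \<open>auto intro!: derivative_eq_intros\<close>)
  then have "((\<lambda>t. (f (x + t * h) - f x) / t) \<longlongrightarrow> D * h) (at 0)"
    by (simp add: DERIV_def)
  moreover have "filterlim e (at 0) sequentially"
    using e by (auto simp: filterlim_at)
  ultimately show ?thesis by (rule filterlim_compose)
qed

text \<open>
One half of the Schwinger-Dyson equation. Moving X to X + \<epsilon> g cannot lower the energy. The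
difference quotient of the logarithmic part is ln (1 + \<epsilon> z) / \<epsilon>, with z the difference
quotient of g along X, and its limit is z. The field g need not be smooth, only its quotient
must be bounded below: this bounds the logarithms below, and Fatou's lemma passes to the limit
in the direction that is wanted. For the potential part, convexity squeezes the
difference quotient between derivatives of u at X and at X + \<epsilon> g, so dominated convergence applies.
\<close>

lemma gibbs_first_variation:
  fixes X g :: "'a \<Rightarrow> real" and u u' :: "real \<Rightarrow> real"
  assumes M: "prob_space M" and X [measurable]: "X \<in> borel_measurable M"
    and g [measurable]: "g \<in> borel_measurable M"
    and gibbs: "free_gibbs_measure u (distr M borel X)"
    and c: "0 < c" and growth: "\<And>x. c * \<bar>x\<bar> - C \<le> u x"
    and der: "\<And>x. (u has_real_derivative u' x) (at x)"
    and u'm [measurable]: "u' \<in> borel_measurable borel"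
    and tangent: "\<And>x y. u x + u' x * (y - x) \<le> u y"
    and K: "\<And>\<omega>. \<omega> \<in> space M \<Longrightarrow> \<bar>g \<omega>\<bar> \<le> K"
    and A: "0 \<le> A"
    and low: "\<And>\<omega> \<omega>'. \<omega> \<in> space M \<Longrightarrow> \<omega>' \<in> space M \<Longrightarrow>
      - A * (X \<omega> - X \<omega>')\<^sup>2 \<le> (g \<omega> - g \<omega>') * (X \<omega> - X \<omega>')"
    and B: "AE \<omega> in M. \<forall>\<theta>. \<bar>\<theta>\<bar> \<le> K \<longrightarrow> \<bar>u' (X \<omega> + \<theta>)\<bar> \<le> B"
  defines "z \<equiv> \<lambda>p. (g (fst p) - g (snd p)) / (X (fst p) - X (snd p))"
  shows "integrable (M \<Otimes>\<^sub>M M) z"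
    and "(\<integral>p. z p \<partial>(M \<Otimes>\<^sub>M M)) \<le> (\<integral>\<omega>. u' (X \<omega>) * g \<omega> \<partial>M)"
proof -
  interpret prob_space M by (rule M)
  interpret P: pair_prob_space M M ..
  have um [measurable]: "u \<in> borel_measurable borel"
    using der by (intro borel_measurable_continuous_onI continuous_at_imp_continuous_on)
      (auto intro: DERIV_isCont)
  have zm [measurable]: "z \<in> borel_measurable (M \<Otimes>\<^sub>M M)"
    unfolding z_def by measurable
  note fin = gibbs_energy_finite_imp[OF M X um c growth free_gibbs_measure_energy_less_top[OF gibbs]]
  have K0: "0 \<le> K" using K not_empty by (meson abs_ge_zero ex_in_conv order_trans)
  have zA: "- A \<le> z p" if "p \<in> space (M \<Otimes>\<^sub>M M)" for p
  proof (cases "X (fst p) = X (snd p)")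
    case False
    let ?d = "X (fst p) - X (snd p)"
    have "- A * ?d\<^sup>2 \<le> (g (fst p) - g (snd p)) * ?d"
      using low that by (auto simp: space_pair_measure)
    then have "- A * ?d\<^sup>2 / ?d\<^sup>2 \<le> (g (fst p) - g (snd p)) * ?d / ?d\<^sup>2"
      by (intro divide_right_mono) auto
    then show ?thesis using False by (simp add: z_def power2_eq_square)
  qed (simp add: z_def A)
  define L where "L = (\<lambda>p. ln \<bar>X (fst p) - X (snd p)\<bar>)"
  have Li: "integrable (M \<Otimes>\<^sub>M M) L" unfolding L_def by (rule fin)
  have Di: "integrable (M \<Otimes>\<^sub>M M) (\<lambda>p. X (fst p) - X (snd p))"
    by (intro Bochner_Integration.integrable_diff integrable_pair_fst integrable_pair_snd fin)

  \<comment> \<open>The factor 1 / (1 + 2 A) keeps 1 + \<epsilon> z at least 1/2.\<close>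
  define \<epsilon> where "\<epsilon> n = inverse (real (Suc n)) * inverse (1 + 2 * A)" for n
  have \<epsilon>0: "0 < \<epsilon> n" for n using A by (simp add: \<epsilon>_def add_pos_nonneg)
  have \<epsilon>A: "\<epsilon> n * A \<le> 1 / 2" and \<epsilon>1: "\<epsilon> n \<le> 1" for n
  proof -
    have "\<epsilon> n \<le> 1 * inverse (1 + 2 * A)"
      unfolding \<epsilon>_def using A by (intro mult_right_mono) (auto simp: inverse_le_1_iff)
    then have *: "\<epsilon> n \<le> inverse (1 + 2 * A)" by simp
    also have "\<dots> \<le> 1" using A by (simp add: inverse_le_1_iff)
    finally show "\<epsilon> n \<le> 1" .
    have "\<epsilon> n * A \<le> inverse (1 + 2 * A) * A" using * A by (rule mult_right_mono)
    also have "\<dots> \<le> 1 / 2" using A by (simp add: field_simps)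
    finally show "\<epsilon> n * A \<le> 1 / 2" .
  qed
  have \<epsilon>lim: "\<epsilon> \<longlonglongrightarrow> 0"
    using tendsto_mult_left_zero[OF LIMSEQ_inverse_real_of_nat, of "inverse (1 + 2 * A)"]
    by (simp add: \<epsilon>_def[abs_def])

  define q where "q n \<omega> = (u (X \<omega> + \<epsilon> n * g \<omega>) - u (X \<omega>)) / \<epsilon> n" for n \<omega>
  define lg where "lg n p = ln (1 + \<epsilon> n * z p)" for n p
  have [measurable]: "q n \<in> borel_measurable M" "lg n \<in> borel_measurable (M \<Otimes>\<^sub>M M)" for n
    unfolding q_def lg_def by measurable
  have qb: "AE \<omega> in M. \<forall>n. \<bar>q n \<omega>\<bar> \<le> B * K"
    using B AE_space
  proof eventually_elim
    case (elim \<omega>)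
    show ?case
    proof
      fix n
      have ek: "\<bar>\<epsilon> n * g \<omega>\<bar> \<le> K"
        using K[OF elim(2)] mult_mono[OF \<epsilon>1[of n] K[OF elim(2)]] \<epsilon>0[of n] K0
        by (simp add: abs_mult)
      have B1: "\<bar>u' (X \<omega>)\<bar> \<le> B" using elim(1)[rule_format, of 0] K0 by simp
      have B2: "\<bar>u' (X \<omega> + \<epsilon> n * g \<omega>)\<bar> \<le> B" using elim(1) ek by blast
      have p1: "\<bar>u' (X \<omega>) * g \<omega>\<bar> \<le> B * K" "\<bar>u' (X \<omega> + \<epsilon> n * g \<omega>) * g \<omega>\<bar> \<le> B * K"
        unfolding abs_mult using B1 B2 K[OF elim(2)] by (auto intro!: mult_mono)
      have "u' (X \<omega>) * g \<omega> \<le> q n \<omega>"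
        using tangent[of "X \<omega>" "X \<omega> + \<epsilon> n * g \<omega>"] \<epsilon>0[of n]
        by (simp add: q_def pos_le_divide_eq algebra_simps)
      moreover have "q n \<omega> \<le> u' (X \<omega> + \<epsilon> n * g \<omega>) * g \<omega>"
        using tangent[of "X \<omega> + \<epsilon> n * g \<omega>" "X \<omega>"] \<epsilon>0[of n]
        by (simp add: q_def pos_divide_le_eq algebra_simps)
      ultimately show "\<bar>q n \<omega>\<bar> \<le> B * K" using p1 by linarith
    qed
  qed
  have qi: "integrable M (q n)" for n
    using qb by (intro integrable_const_bound[where B = "B * K"]) (auto elim!: eventually_mono)
  have lglow: "- 2 * A \<le> lg n p / \<epsilon> n" if "p \<in> space (M \<Otimes>\<^sub>M M)" for n p
  proof -
    have "- (\<epsilon> n * A) \<le> \<epsilon> n * z p"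
      using mult_left_mono[OF zA[OF that], of "\<epsilon> n"] \<epsilon>0[of n] by simp
    then have "- 2 * (\<epsilon> n * A) \<le> lg n p"
      unfolding lg_def using \<epsilon>A[of n] \<epsilon>0[of n] A by (intro ln_one_plus_ge) auto
    then show ?thesis using \<epsilon>0[of n] by (simp add: pos_le_divide_eq algebra_simps)
  qed
  have key: "integrable (M \<Otimes>\<^sub>M M) (lg n) \<and> (\<integral>p. lg n p \<partial>(M \<Otimes>\<^sub>M M)) \<le> \<epsilon> n * (\<integral>\<omega>. q n \<omega> \<partial>M)" for n
  proof -
    define Z where "Z \<omega> = X \<omega> + \<epsilon> n * g \<omega>" for \<omega>
    have Zm [measurable]: "Z \<in> borel_measurable M" unfolding Z_def by measurable
    have fac: "AE p in M \<Otimes>\<^sub>M M. Z (fst p) - Z (snd p) = (X (fst p) - X (snd p)) * (1 + \<epsilon> n * z p)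
        \<and> 1 / 2 \<le> 1 + \<epsilon> n * z p \<and> X (fst p) \<noteq> X (snd p) \<and> p \<in> space (M \<Otimes>\<^sub>M M)"
      using fin(3) AE_space
    proof eventually_elim
      case (elim p)
      have "- (\<epsilon> n * A) \<le> \<epsilon> n * z p"
        using mult_left_mono[OF zA[OF elim(2)], of "\<epsilon> n"] \<epsilon>0[of n] by simp
      then have "1 / 2 \<le> 1 + \<epsilon> n * z p" using \<epsilon>A[of n] by linarith
      moreover have "Z (fst p) - Z (snd p) = (X (fst p) - X (snd p)) * (1 + \<epsilon> n * z p)"
        using elim(1) by (simp add: Z_def z_def field_simps)
      ultimately show ?case using elim by simp
    qed
    have lnZ: "AE p in M \<Otimes>\<^sub>M M. ln \<bar>Z (fst p) - Z (snd p)\<bar> = L p + lg n p"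
      using fac by eventually_elim (auto simp: L_def lg_def abs_mult ln_mult)
    have lgi: "integrable (M \<Otimes>\<^sub>M M) (lg n)"
    proof (rule Bochner_Integration.integrable_bound)
      show "integrable (M \<Otimes>\<^sub>M M) (\<lambda>p. \<bar>X (fst p) - X (snd p)\<bar> + (2 * K + 1) + \<bar>L p\<bar>)"
        by (intro Bochner_Integration.integrable_add integrable_abs Di Li P.integrable_const)
      show "AE p in M \<Otimes>\<^sub>M M. norm (lg n p) \<le> norm (\<bar>X (fst p) - X (snd p)\<bar> + (2 * K + 1) + \<bar>L p\<bar>)"
        using fac lnZ
      proof eventually_elim
        case (elim p)
        have sp: "fst p \<in> space M" "snd p \<in> space M" using elim by (auto simp: space_pair_measure)
        have "Z (fst p) - Z (snd p) \<noteq> 0" using elim by auto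
        then have "ln \<bar>Z (fst p) - Z (snd p)\<bar> \<le> \<bar>Z (fst p) - Z (snd p)\<bar>"
          using ln_le_minus_one[of "\<bar>Z (fst p) - Z (snd p)\<bar>"] by simp
        also have "\<dots> \<le> \<bar>X (fst p) - X (snd p)\<bar> + \<bar>\<epsilon> n * (g (fst p) - g (snd p))\<bar>"
          by (simp add: Z_def algebra_simps)
        also have "\<bar>\<epsilon> n * (g (fst p) - g (snd p))\<bar> \<le> 1 * \<bar>g (fst p) - g (snd p)\<bar>"
          unfolding abs_mult using \<epsilon>0[of n] \<epsilon>1[of n] by (intro mult_right_mono) auto
        also have "1 * \<bar>g (fst p) - g (snd p)\<bar> \<le> 2 * K"
          using K[OF sp(1)] K[OF sp(2)] by simp
        finally have up: "lg n p \<le> \<bar>X (fst p) - X (snd p)\<bar> + 2 * K + \<bar>L p\<bar>"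
          using elim by linarith
        have "ln (1 / 2) \<le> lg n p" unfolding lg_def using elim by simp
        moreover have "- 1 \<le> ln (1 / 2 :: real)"
          using ln_le_minus_one[of 2] by (simp add: ln_div)
        ultimately have "\<bar>lg n p\<bar> \<le> \<bar>X (fst p) - X (snd p)\<bar> + (2 * K + 1) + \<bar>L p\<bar>"
          using up K0 by linarith
        then show ?case by simp
      qed
    qed simp
    have uZ: "u (Z \<omega>) = u (X \<omega>) + \<epsilon> n * q n \<omega>" for \<omega>
      using \<epsilon>0[of n] by (simp add: q_def Z_def)
    have uZi: "integrable M (\<lambda>\<omega>. u (Z \<omega>))"
      unfolding uZ by (intro Bochner_Integration.integrable_add integrable_mult_right fin qi)
    have lnZi: "integrable (M \<Otimes>\<^sub>M M) (\<lambda>p. ln \<bar>Z (fst p) - Z (snd p)\<bar>)"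
      using lnZ Bochner_Integration.integrable_add[OF Li lgi]
      by (subst integrable_cong_AE[where g = "\<lambda>p. L p + lg n p"]) (auto simp: L_def)
    have Zne: "AE p in M \<Otimes>\<^sub>M M. Z (fst p) \<noteq> Z (snd p)"
      using fac by eventually_elim auto
    \<comment> \<open>Comparing the energies of X and Z yields the inequality before the limit.\<close>
    have EX: "gibbs_energy u (distr M borel X) = ereal ((\<integral>\<omega>. u (X \<omega>) \<partial>M) - (\<integral>p. L p \<partial>(M \<Otimes>\<^sub>M M)))"
      unfolding L_def by (rule gibbs_energy_distr[OF M X um fin(1) fin(4) fin(3)])
    have "gibbs_energy u (distr M borel Z)
        = ereal ((\<integral>\<omega>. u (Z \<omega>) \<partial>M) - (\<integral>p. ln \<bar>Z (fst p) - Z (snd p)\<bar> \<partial>(M \<Otimes>\<^sub>M M)))"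
      by (rule gibbs_energy_distr[OF M Zm um uZi lnZi Zne])
    also have "(\<integral>\<omega>. u (Z \<omega>) \<partial>M) = (\<integral>\<omega>. u (X \<omega>) \<partial>M) + \<epsilon> n * (\<integral>\<omega>. q n \<omega> \<partial>M)"
      unfolding uZ using fin(1) qi by simp
    also have "(\<integral>p. ln \<bar>Z (fst p) - Z (snd p)\<bar> \<partial>(M \<Otimes>\<^sub>M M)) = (\<integral>p. L p + lg n p \<partial>(M \<Otimes>\<^sub>M M))"
      using lnZ by (intro integral_cong_AE) (auto simp: L_def)
    also have "\<dots> = (\<integral>p. L p \<partial>(M \<Otimes>\<^sub>M M)) + (\<integral>p. lg n p \<partial>(M \<Otimes>\<^sub>M M))"
      using Li lgi by simp
    finally have EZ: "gibbs_energy u (distr M borel Z)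
        = ereal ((\<integral>\<omega>. u (X \<omega>) \<partial>M) + \<epsilon> n * (\<integral>\<omega>. q n \<omega> \<partial>M)
          - ((\<integral>p. L p \<partial>(M \<Otimes>\<^sub>M M)) + (\<integral>p. lg n p \<partial>(M \<Otimes>\<^sub>M M))))" .
    have "borel_prob (distr M borel Z)"
      by (simp add: borel_prob_def prob_space_distr)
    moreover have "is_arg_min (gibbs_energy u) borel_prob (distr M borel X)"
      using gibbs by (simp add: free_gibbs_measure_def)
    ultimately have "\<not> gibbs_energy u (distr M borel Z) < gibbs_energy u (distr M borel X)"
      unfolding is_arg_min_def by blast
    then show ?thesis using lgi unfolding EX EZ by simp
  qed

  define I where "I = (\<integral>\<omega>. u' (X \<omega>) * g \<omega> \<partial>M)"
  have qlim: "(\<lambda>n. \<integral>\<omega>. q n \<omega> \<partial>M) \<longlonglongrightarrow> I"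
    unfolding I_def
  proof (rule integral_dominated_convergence[where w = "\<lambda>_. B * K"])
    show "AE \<omega> in M. (\<lambda>n. q n \<omega>) \<longlonglongrightarrow> u' (X \<omega>) * g \<omega>"
      unfolding q_def using \<epsilon>0
      by (intro AE_I2 difference_quotient_tendsto[OF der \<epsilon>lim]) (metis less_irrefl)
    show "AE \<omega> in M. norm (q n \<omega>) \<le> B * K" for n
      using qb by eventually_elim auto
  qed auto
  have lglim: "(\<lambda>n. lg n p / \<epsilon> n) \<longlonglongrightarrow> z p" for p
  proof -
    have "((\<lambda>x. ln x) has_real_derivative 1) (at (1::real))"
      using DERIV_ln[of 1] by simp
    from difference_quotient_tendsto[OF this \<epsilon>lim, of "z p"] \<epsilon>0
    show ?thesis by (simp add: lg_def less_imp_neq[symmetric])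
  qed
  have intlg: "(\<integral>\<^sup>+p. ennreal (lg n p / \<epsilon> n + 2 * A) \<partial>(M \<Otimes>\<^sub>M M)) \<le> ennreal ((\<integral>\<omega>. q n \<omega> \<partial>M) + 2 * A)"
    and nonneg: "0 \<le> (\<integral>\<omega>. q n \<omega> \<partial>M) + 2 * A" for n
  proof -
    have i: "integrable (M \<Otimes>\<^sub>M M) (\<lambda>p. lg n p / \<epsilon> n + 2 * A)"
      using key[of n] by (intro Bochner_Integration.integrable_add integrable_divide P.integrable_const) auto
    have nn: "AE p in M \<Otimes>\<^sub>M M. 0 \<le> lg n p / \<epsilon> n + 2 * A"
      using lglow by (intro AE_I2) (smt (verit))
    have e: "(\<integral>p. lg n p / \<epsilon> n + 2 * A \<partial>(M \<Otimes>\<^sub>M M)) = (\<integral>p. lg n p \<partial>(M \<Otimes>\<^sub>M M)) / \<epsilon> n + 2 * A"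
      using key[of n] by (subst Bochner_Integration.integral_add) (auto simp: P.prob_space)
    have le: "(\<integral>p. lg n p \<partial>(M \<Otimes>\<^sub>M M)) / \<epsilon> n + 2 * A \<le> (\<integral>\<omega>. q n \<omega> \<partial>M) + 2 * A"
      using key[of n] \<epsilon>0[of n] by (simp add: pos_divide_le_eq mult.commute)
    show "0 \<le> (\<integral>\<omega>. q n \<omega> \<partial>M) + 2 * A"
      using integral_nonneg_AE[OF nn] le unfolding e by linarith
    show "(\<integral>\<^sup>+p. ennreal (lg n p / \<epsilon> n + 2 * A) \<partial>(M \<Otimes>\<^sub>M M)) \<le> ennreal ((\<integral>\<omega>. q n \<omega> \<partial>M) + 2 * A)"
      unfolding nn_integral_eq_integral[OF i nn] e by (rule ennreal_leI[OF le])
  qed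
  have rlim: "(\<lambda>n. (\<integral>\<omega>. q n \<omega> \<partial>M) + 2 * A) \<longlonglongrightarrow> I + 2 * A"
    by (intro tendsto_intros qlim)
  have I0: "0 \<le> I + 2 * A"
    using nonneg by (intro LIMSEQ_le_const[OF rlim]) auto
  have "(\<integral>\<^sup>+p. ennreal (z p + 2 * A) \<partial>(M \<Otimes>\<^sub>M M))
      = (\<integral>\<^sup>+p. liminf (\<lambda>n. ennreal (lg n p / \<epsilon> n + 2 * A)) \<partial>(M \<Otimes>\<^sub>M M))"
    by (intro nn_integral_cong lim_imp_Liminf[symmetric] tendsto_ennrealI tendsto_intros lglim) auto
  also have "\<dots> \<le> liminf (\<lambda>n. \<integral>\<^sup>+p. ennreal (lg n p / \<epsilon> n + 2 * A) \<partial>(M \<Otimes>\<^sub>M M))"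
    by (intro nn_integral_liminf) simp
  also have "\<dots> \<le> liminf (\<lambda>n. ennreal ((\<integral>\<omega>. q n \<omega> \<partial>M) + 2 * A))"
    by (intro Liminf_mono always_eventually allI intlg)
  also have "\<dots> = ennreal (I + 2 * A)"
    by (intro lim_imp_Liminf tendsto_ennrealI rlim) auto
  finally have fatou: "(\<integral>\<^sup>+p. ennreal (z p + 2 * A) \<partial>(M \<Otimes>\<^sub>M M)) \<le> ennreal (I + 2 * A)" .
  have z2: "AE p in M \<Otimes>\<^sub>M M. 0 \<le> z p + 2 * A"
    using zA A by (intro AE_I2) (smt (verit))
  have i2: "integrable (M \<Otimes>\<^sub>M M) (\<lambda>p. z p + 2 * A)"
    using z2 fatou by (intro integrableI_nonneg) (auto simp: le_less_trans)
  have "integrable (M \<Otimes>\<^sub>M M) (\<lambda>p. (z p + 2 * A) - 2 * A)"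
    by (intro Bochner_Integration.integrable_diff i2 P.integrable_const)
  then show zi: "integrable (M \<Otimes>\<^sub>M M) z" by simp
  have "(\<integral>p. z p + 2 * A \<partial>(M \<Otimes>\<^sub>M M)) \<le> I + 2 * A"
    using fatou I0 unfolding nn_integral_eq_integral[OF i2 z2] by (simp add: ennreal_le_iff)
  moreover have "(\<integral>p. z p + 2 * A \<partial>(M \<Otimes>\<^sub>M M)) = (\<integral>p. z p \<partial>(M \<Otimes>\<^sub>M M)) + 2 * A"
    using zi by (simp add: P.prob_space)
  ultimately show "(\<integral>p. z p \<partial>(M \<Otimes>\<^sub>M M)) \<le> (\<integral>\<omega>. u' (X \<omega>) * g \<omega> \<partial>M)"
    by (simp add: I_def)
qed

section \<open>Strictly convex potentials and their Legendre transforms\<close>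

lemma C2_real_DERIV:
  assumes "C2_real u"
  shows "(u has_real_derivative deriv u x) (at x)"
  using assms by (auto simp: C2_real_def C1_differentiable_on_eq DERIV_deriv_iff_real_differentiable)

lemma C2_real_continuous_deriv:
  assumes "C2_real u"
  shows "continuous_on A (deriv u)"
  using assms unfolding C2_real_def C1_differentiable_on_eq
  by (auto intro!: continuous_at_imp_continuous_on differentiable_imp_continuous_within)

lemma C2_real_deriv_lipschitz:
  assumes "C2_real u"
  shows "\<exists>A\<ge>0. \<forall>x\<in>{-R..R}. \<forall>y\<in>{-R..R}. \<bar>deriv u x - deriv u y\<bar> \<le> A * \<bar>x - y\<bar>"
proof -
  obtain D where D: "\<And>x. (deriv u has_real_derivative D x) (at x)" and cont: "continuous_on UNIV D"
    using assms unfolding C2_real_def C1_differentiable_on_def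
    by (auto simp: has_real_derivative_iff_has_vector_derivative)
  have "bounded (D ` {-R..R})"
    by (intro compact_imp_bounded compact_continuous_image compact_Icc continuous_on_subset[OF cont]) auto
  then obtain A where A: "0 < A" "\<And>x. x \<in> {-R..R} \<Longrightarrow> \<bar>D x\<bar> \<le> A"
    by (auto simp: bounded_pos)
  have "\<bar>deriv u x - deriv u y\<bar> \<le> A * \<bar>x - y\<bar>" if "x \<in> {-R..R}" "y \<in> {-R..R}" for x y
    using field_differentiable_bound[of "{-R..R}" "deriv u" D A x y] that A D
    by (auto intro: has_field_derivative_at_within)
  then show ?thesis using A(1) by (intro exI[of _ A]) auto
qed

lemma strictly_convex_imp_convex_on:
  assumes "strictly_convex u"
  shows "convex_on UNIV u"
proof (rule convex_onI)
  fix t x y :: real assume t: "0 < t" "t < 1"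
  show "u ((1 - t) *\<^sub>R x + t *\<^sub>R y) \<le> (1 - t) * u x + t * u y"
  proof (cases "x = y")
    case True
    then have "(1 - t) *\<^sub>R x + t *\<^sub>R y = y" by (simp add: algebra_simps)
    with True show ?thesis by (simp add: algebra_simps)
  next
    case False
    with t assms show ?thesis by (auto simp: strictly_convex_def intro: less_imp_le)
  qed
qed simp

lemma strictly_convex_above_tangent:
  assumes conv: "strictly_convex u" and der: "(u has_real_derivative d) (at x)"
  shows "u x + d * (y - x) \<le> u y" and "y \<noteq> x \<Longrightarrow> u x + d * (y - x) < u y"
proof -
  have tangent: "u x + d * (y - x) \<le> u y" for y
    using convex_on_imp_above_tangent[OF strictly_convex_imp_convex_on[OF conv], of x y d] der
    by simp
  then show "u x + d * (y - x) \<le> u y" .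
  assume "y \<noteq> x"
  then have "u ((1 - 1 / 2) * x + 1 / 2 * y) < (1 - 1 / 2) * u x + 1 / 2 * u y"
    using conv unfolding strictly_convex_def by (elim allE[of _ x] allE[of _ y] allE[of _ "1 / 2"]) auto
  moreover have "u x + d * (((1 - 1 / 2) * x + 1 / 2 * y) - x) \<le> u ((1 - 1 / 2) * x + 1 / 2 * y)"
    by (rule tangent)
  ultimately show "u x + d * (y - x) < u y" by (simp add: algebra_simps)
qed

lemma strictly_convex_strict_mono_deriv:
  assumes conv: "strictly_convex u" and der: "\<And>x. (u has_real_derivative u' x) (at x)"
  shows "strict_mono u'"
proof (rule strict_monoI)
  fix x y :: real assume "x < y"
  then have "u x + u' x * (y - x) < u y" "u y + u' y * (x - y) < u x"
    by (auto intro!: strictly_convex_above_tangent(2)[OF conv der])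
  then have "(u' x - u' y) * (y - x) < 0" by (simp add: algebra_simps)
  with \<open>x < y\<close> show "u' x < u' y" by (simp add: mult_less_0_iff)
qed

lemma legendre_at_derivative:
  assumes tangent: "\<And>x. u x0 + d * (x - x0) \<le> u x"
  shows "legendre u d = ereal (x0 * d - u x0)"
  unfolding legendre_def
proof (rule antisym)
  show "(SUP x. ereal (x * d - u x)) \<le> ereal (x0 * d - u x0)"
    using tangent by (intro SUP_least) (simp add: algebra_simps)
  show "ereal (x0 * d - u x0) \<le> (SUP x. ereal (x * d - u x))"
    by (rule SUP_upper2[of x0]) auto
qed

lemma continuous_strict_mono_nbhd_in_range:
  fixes f :: "real \<Rightarrow> real"
  assumes cont: "continuous_on UNIV f" and y: "f (x - e) < y" "y < f (x + e)" and e: "0 < e"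
    and mono: "strict_mono f"
  obtains x' where "y = f x'" "\<bar>x' - x\<bar> < e"
proof -
  obtain x' where x': "x - e \<le> x'" "x' \<le> x + e" "f x' = y"
    using IVT'[of f "x - e" y "x + e"] y e continuous_on_subset[OF cont] by auto
  moreover have "x' \<noteq> x - e" "x' \<noteq> x + e" using x'(3) y by auto
  ultimately show thesis by (intro that[of x']) auto
qed

text \<open>
The supremum defining the Legendre transform at u'(x) is attained at x. Comparing the
suprema at u'(x) and u'(x') traps the increment of the transform between x and x' times the
increment of the argument, and x' tends to x because u' is a homeomorphism onto its range.
\<close>

lemma legendre_deriv_deriv:
  assumes conv: "strictly_convex u" and der: "\<And>x. (u has_real_derivative u' x) (at x)"
    and cont: "continuous_on UNIV u'"
  shows "legendre_deriv u (u' x) = x"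
proof -
  have mono: "strict_mono u'" by (rule strictly_convex_strict_mono_deriv[OF conv der])
  note tangent = strictly_convex_above_tangent(1)[OF conv der]
  define \<phi> where "\<phi> y = real_of_ereal (legendre u y)" for y
  have \<phi>: "\<phi> (u' x) = x * u' x - u x" for x
    unfolding \<phi>_def by (simp add: legendre_at_derivative[OF tangent])
  have "((\<lambda>y. (\<phi> y - \<phi> (u' x)) / (y - u' x)) \<longlongrightarrow> x) (at (u' x))"
  proof (rule tendstoI)
    fix e :: real assume e: "0 < e"
    have lr: "u' (x - e) < u' x" "u' x < u' (x + e)"
      using e by (auto intro!: strict_monoD[OF mono])
    have "\<forall>\<^sub>F y in at (u' x). y \<in> {u' (x - e)<..<u' (x + e)} - {u' x}"
      by (rule eventually_at_in_open) (use lr in auto)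
    then show "\<forall>\<^sub>F y in at (u' x). dist ((\<phi> y - \<phi> (u' x)) / (y - u' x)) x < e"
    proof eventually_elim
      case (elim y)
      obtain x' where x': "y = u' x'" "\<bar>x' - x\<bar> < e"
        by (rule continuous_strict_mono_nbhd_in_range[OF cont, of x e y]) (use elim e mono in auto)
      have "x * u' x' - u x \<le> x' * u' x' - u x'" "x' * u' x - u x' \<le> x * u' x - u x"
        using tangent[of x' x] tangent[of x x'] by (auto simp: algebra_simps)
      then have lo: "x * (y - u' x) \<le> \<phi> y - \<phi> (u' x)" and hi: "\<phi> y - \<phi> (u' x) \<le> x' * (y - u' x)"
        unfolding x'(1) \<phi> by (auto simp: algebra_simps)
      have "\<bar>(\<phi> y - \<phi> (u' x)) - x * (y - u' x)\<bar> \<le> \<bar>(x' - x) * (y - u' x)\<bar>"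
        using lo hi by (simp add: left_diff_distrib)
      also have "\<dots> < e * \<bar>y - u' x\<bar>"
        unfolding abs_mult using x'(2) elim by (intro mult_strict_right_mono) auto
      finally have "\<bar>(\<phi> y - \<phi> (u' x)) - x * (y - u' x)\<bar> / \<bar>y - u' x\<bar> < e"
        using elim by (simp add: divide_less_eq)
      then show ?case
        using elim by (simp add: dist_real_def abs_divide[symmetric] diff_divide_distrib)
    qed
  qed
  then have "(\<phi> has_real_derivative x) (at (u' x))"
    by (simp add: has_field_derivative_iff)
  then show ?thesis
    unfolding legendre_deriv_def \<phi>_def[abs_def] by (rule DERIV_imp_deriv)
qed

lemma convex_linear_growth:
  assumes tangent: "\<And>x y. u x + u' x * (y - x) \<le> u y" and p: "u' p < 0" and q: "0 < u' q"
  obtains c C :: real where "0 < c" "\<And>x. c * \<bar>x\<bar> - C \<le> u x"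
proof
  let ?c = "min (- u' p) (u' q)"
  let ?C = "max (u' q * q - u q) (u' p * p - u p)"
  show "0 < ?c" using p q by simp
  show "?c * \<bar>x\<bar> - ?C \<le> u x" for x
  proof (cases "0 \<le> x")
    case True
    then have "?c * \<bar>x\<bar> \<le> u' q * x" by (simp add: mult_right_mono)
    then show ?thesis using tangent[of q x] by (simp add: algebra_simps max_def)
  next
    case False
    then have "?c * \<bar>x\<bar> \<le> - u' p * - x" by (intro mult_mono) (use p in auto)
    then show ?thesis using tangent[of p x] by (simp add: algebra_simps max_def)
  qed
qed

section \<open>The distance bound along a monotone coupling\<close>

text \<open>
With t = sqrt (r s) the left side is at most (1 - t)^2, since r + s is at least 2 t, and
(1 - t)^2 is at most (1 - t)^2 (1 + t)^2 = (r s - 1)^2.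
\<close>

lemma slope_product_inequality:
  fixes r s :: real
  assumes "0 \<le> r" "0 \<le> s"
  shows "r * s - s - r + 1 \<le> (r * s - 1)\<^sup>2"
proof -
  define t where "t = sqrt (r * s)"
  have t: "0 \<le> t" "r * s = t\<^sup>2" using assms by (auto simp: t_def)
  have "2 * t \<le> r + s" using arith_geo_mean_sqrt[OF assms] by (simp add: t_def)
  then have "r * s - s - r + 1 \<le> (1 - t)\<^sup>2 * 1" by (simp add: t power2_diff)
  also have "\<dots> \<le> (1 - t)\<^sup>2 * (1 + t)\<^sup>2"
    using t(1) by (intro mult_left_mono one_le_power) auto
  also have "\<dots> = (r * s - 1)\<^sup>2" unfolding t(2) by (simp add: power2_eq_square algebra_simps)
  finally show ?thesis .
qed

lemma AE_semicircular_neq: "AE y in semicircular. y \<noteq> x"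
  unfolding semicircular_eq using AE_lborel_singleton[of x]
  by (subst AE_density) (auto elim: eventually_mono)

lemma AE_pair_neq_of_semicircular:
  fixes S :: "'a \<Rightarrow> real"
  assumes "prob_space M" and S [measurable]: "S \<in> borel_measurable M"
    and law: "distr M borel S = semicircular"
  shows "AE p in M \<Otimes>\<^sub>M M. S (fst p) \<noteq> S (snd p)"
proof -
  interpret prob_space M by fact
  interpret P: pair_prob_space M M ..
  have "AE \<omega>' in M. S \<omega> \<noteq> S \<omega>'" for \<omega>
  proof -
    have "AE y in distr M borel S. y \<noteq> S \<omega>"
      unfolding law by (rule AE_semicircular_neq)
    then have "AE \<omega>' in M. S \<omega>' \<noteq> S \<omega>" by (rule AE_distrD[rotated]) simp
    then show ?thesis by eventually_elim auto
  qed
  then show ?thesis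
    by (intro P.AE_pair_measure) auto
qed

text \<open>
If u' exceeds the bound C somewhere, then X is bounded on that side, and so is X + \<theta>;
otherwise u' itself is bounded on that side. This replaces compactness of the support
of X.
\<close>

lemma mono_shift_bounded:
  fixes u' :: "real \<Rightarrow> real"
  assumes mono: "mono u'" and C: "AE \<omega> in M. \<bar>u' (X \<omega>)\<bar> \<le> C"
  obtains B where "AE \<omega> in M. \<forall>\<theta>. \<bar>\<theta>\<bar> \<le> K \<longrightarrow> \<bar>u' (X \<omega> + \<theta>)\<bar> \<le> B"
proof -
  obtain B1 where B1: "\<And>x \<theta>. \<bar>u' x\<bar> \<le> C \<Longrightarrow> \<bar>\<theta>\<bar> \<le> K \<Longrightarrow> u' (x + \<theta>) \<le> B1"
  proof (cases "\<exists>x. C < u' x")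
    case True
    then obtain x1 where x1: "C < u' x1" by auto
    have "u' (x + \<theta>) \<le> u' (x1 + K)" if "\<bar>u' x\<bar> \<le> C" "\<bar>\<theta>\<bar> \<le> K" for x \<theta>
    proof -
      have "x \<le> x1" using monoD[OF mono, of x1 x] x1 that(1) by linarith
      then show ?thesis using that(2) by (intro monoD[OF mono]) linarith
    qed
    then show thesis by (rule that)
  next
    case False
    then show thesis by (intro that[of C]) (auto simp: not_less)
  qed
  obtain B2 where B2: "\<And>x \<theta>. \<bar>u' x\<bar> \<le> C \<Longrightarrow> \<bar>\<theta>\<bar> \<le> K \<Longrightarrow> B2 \<le> u' (x + \<theta>)"
  proof (cases "\<exists>x. u' x < - C")
    case True
    then obtain x1 where x1: "u' x1 < - C" by auto
    have "u' (x1 - K) \<le> u' (x + \<theta>)" if "\<bar>u' x\<bar> \<le> C" "\<bar>\<theta>\<bar> \<le> K" for x \<theta>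
    proof -
      have "x1 \<le> x" using monoD[OF mono, of x x1] x1 that(1) by linarith
      then show ?thesis using that(2) by (intro monoD[OF mono]) linarith
    qed
    then show thesis by (rule that)
  next
    case False
    then show thesis by (intro that[of "- C"]) (auto simp: not_less)
  qed
  show thesis
  proof (rule that)
    show "AE \<omega> in M. \<forall>\<theta>. \<bar>\<theta>\<bar> \<le> K \<longrightarrow> \<bar>u' (X \<omega> + \<theta>)\<bar> \<le> max B1 (- B2)"
      using C
    proof eventually_elim
      case (elim \<omega>)
      show ?case
      proof (intro allI impI)
        fix \<theta> :: real assume "\<bar>\<theta>\<bar> \<le> K"
        with B1[OF elim] B2[OF elim] show "\<bar>u' (X \<omega> + \<theta>)\<bar> \<le> max B1 (- B2)"
          by (smt (verit) max.cobounded1 max.cobounded2)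
      qed
    qed
  qed
qed

definition truncation :: "real \<Rightarrow> real \<Rightarrow> real" where
  "truncation R x = max (- R) (min R x)"

lemma truncation_measurable [measurable]: "truncation R \<in> borel_measurable borel"
  unfolding truncation_def by measurable

lemma truncation_mono: "x \<le> y \<Longrightarrow> truncation R x \<le> truncation R y"
  by (auto simp: truncation_def)

lemma truncation_range: "0 \<le> R \<Longrightarrow> truncation R x \<in> {-R..R}"
  by (auto simp: truncation_def)

text \<open>
Composing with a truncation can only flatten a monotone function. For a locally Lipschitz u'
the truncated slopes are bounded, and at every truncation level their mean is at most that of
the original slopes.
\<close>

lemma truncated_slope_bounds:
  fixes u' :: "real \<Rightarrow> real"
  assumes mono: "mono u'" and R: "0 \<le> R"
  shows "0 \<le> (u' (truncation R x) - u' (truncation R y)) / (x - y)"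
    and "(u' (truncation R x) - u' (truncation R y)) / (x - y) \<le> (u' x - u' y) / (x - y)"
proof -
  have *: "0 \<le> (u' (truncation R x) - u' (truncation R y)) / (x - y) \<and>
      (u' (truncation R x) - u' (truncation R y)) / (x - y) \<le> (u' x - u' y) / (x - y)" if "y < x" for x y
  proof -
    have "u' (truncation R y) \<le> u' (truncation R x)" "u' y \<le> u' x"
      using that by (auto intro!: monoD[OF mono] truncation_mono)
    moreover have "u' (truncation R x) - u' (truncation R y) \<le> u' x - u' y"
    proof -
      consider "x \<le> - R" | "R \<le> y" | "- R \<le> x" "y \<le> R" using R by linarith
      then show ?thesis
      proof cases
        case 1
        then have "truncation R x = - R" "truncation R y = - R" using that R by (auto simp: truncation_def)
        then show ?thesis using \<open>u' y \<le> u' x\<close> by simp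
      next
        case 2
        then have "truncation R x = R" "truncation R y = R" using that R by (auto simp: truncation_def)
        then show ?thesis using \<open>u' y \<le> u' x\<close> by simp
      next
        case 3
        then have "u' (truncation R x) \<le> u' x" "u' y \<le> u' (truncation R y)"
          by (auto intro!: monoD[OF mono] simp: truncation_def)
        then show ?thesis by simp
      qed
    qed
    ultimately show ?thesis using that by (simp add: divide_right_mono)
  qed
  have flip: "(a - b) / (x - y) = (b - a) / (y - x)" for a b :: real
    by (metis minus_diff_eq minus_divide_divide)
  show "0 \<le> (u' (truncation R x) - u' (truncation R y)) / (x - y)"
    using *[of x y] *[of y x] flip[of "u' (truncation R x)"] by (cases x y rule: linorder_cases) auto
  show "(u' (truncation R x) - u' (truncation R y)) / (x - y) \<le> (u' x - u' y) / (x - y)"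
    using *[of x y] *[of y x] flip[of "u' (truncation R x)"] flip[of "u' x"]
    by (cases x y rule: linorder_cases) auto
qed

text \<open>
Let Y = u'(X), and let a, s, r be the difference quotients of Y along X, of S along X and of Y
along S over two independent copies, so that a = r s. The first variation along S - Y gives
E Y^2 - E Y S \<le> E (a - s), and the Stein inequality gives E r \<le> E S Y. Since E S^2 = 1,
E (Y - S)^2 \<le> E (a - s - r + 1), and the claim follows from the pointwise inequality
slope_product_inequality.

The quotient of S - Y along X is s - a, which need not be bounded below when X ranges over the
whole line. Therefore Y is first replaced by the value of u' at the truncation of X.
\<close>

lemma gibbs_monotone_coupling:
  fixes X S :: "'a \<Rightarrow> real" and u u' :: "real \<Rightarrow> real"
  assumes M: "prob_space M" and X [measurable]: "X \<in> borel_measurable M"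
    and S [measurable]: "S \<in> borel_measurable M"
    and law: "distr M borel S = semicircular"
    and S2: "\<And>\<omega>. \<omega> \<in> space M \<Longrightarrow> \<bar>S \<omega>\<bar> \<le> 2"
    and co: "\<And>\<omega> \<omega>'. \<omega> \<in> space M \<Longrightarrow> \<omega>' \<in> space M \<Longrightarrow> 0 \<le> (X \<omega> - X \<omega>') * (S \<omega> - S \<omega>')"
    and gibbs: "free_gibbs_measure u (distr M borel X)"
    and c: "0 < c" and growth: "\<And>x. c * \<bar>x\<bar> - C \<le> u x"
    and der: "\<And>x. (u has_real_derivative u' x) (at x)"
    and mono: "mono u'"
    and lip: "\<And>R. \<exists>A\<ge>0. \<forall>x\<in>{-R..R}. \<forall>y\<in>{-R..R}. \<bar>u' x - u' y\<bar> \<le> A * \<bar>x - y\<bar>"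
    and tangent: "\<And>x y. u x + u' x * (y - x) \<le> u y"
    and Yb: "AE \<omega> in M. \<bar>u' (X \<omega>)\<bar> \<le> D"
  defines "a \<equiv> \<lambda>p. (u' (X (fst p)) - u' (X (snd p))) / (X (fst p) - X (snd p))"
  assumes fin: "integrable (M \<Otimes>\<^sub>M M) (\<lambda>p. (a p - 1)\<^sup>2)"
  shows "integrable M (\<lambda>\<omega>. (u' (X \<omega>) - S \<omega>)\<^sup>2)"
    and "(\<integral>\<omega>. (u' (X \<omega>) - S \<omega>)\<^sup>2 \<partial>M) \<le> (\<integral>p. (a p - 1)\<^sup>2 \<partial>(M \<Otimes>\<^sub>M M))"
proof -
  interpret prob_space M by (rule M)
  interpret P: pair_prob_space M M ..
  have [measurable]: "u' \<in> borel_measurable borel" by (rule borel_measurable_mono[OF mono])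
  have [measurable]: "u \<in> borel_measurable borel"
    using der by (intro borel_measurable_continuous_onI continuous_at_imp_continuous_on)
      (auto intro: DERIV_isCont)
  have am [measurable]: "a \<in> borel_measurable (M \<Otimes>\<^sub>M M)" unfolding a_def by measurable
  define Y where "Y \<omega> = u' (X \<omega>)" for \<omega>
  have [measurable]: "Y \<in> borel_measurable M" unfolding Y_def by measurable
  have YD: "AE \<omega> in M. \<bar>Y \<omega>\<bar> \<le> D" using Yb by (simp add: Y_def)
  have D0: "0 \<le> D"
  proof -
    obtain \<omega> where "\<bar>Y \<omega>\<bar> \<le> D" using eventually_happens'[OF ae_filter_bot YD] by blast
    then show ?thesis by linarith
  qed
  define s where "s p = (S (fst p) - S (snd p)) / (X (fst p) - X (snd p))" for p
  define r where "r p = (Y (fst p) - Y (snd p)) / (S (fst p) - S (snd p))" for p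
  have [measurable]: "s \<in> borel_measurable (M \<Otimes>\<^sub>M M)" "r \<in> borel_measurable (M \<Otimes>\<^sub>M M)"
    unfolding s_def r_def by measurable
  have div0: "0 \<le> x / y" if "0 \<le> x * y" for x y :: real
    using that unfolding zero_le_divide_iff zero_le_mult_iff by blast
  have mono_mult: "0 \<le> (u' x - u' y) * (x - y)" for x y
    using monoD[OF mono, of x y] monoD[OF mono, of y x]
    by (cases "x \<le> y") (auto simp: zero_le_mult_iff)
  have s0: "0 \<le> s p" if "p \<in> space (M \<Otimes>\<^sub>M M)" for p
    unfolding s_def using co that by (intro div0) (auto simp: space_pair_measure mult.commute)
  have coY: "0 \<le> (Y \<omega> - Y \<omega>') * (S \<omega> - S \<omega>')" if "\<omega> \<in> space M" "\<omega>' \<in> space M" for \<omega> \<omega>'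
    using co[OF that] monoD[OF mono, of "X \<omega>" "X \<omega>'"] monoD[OF mono, of "X \<omega>'" "X \<omega>"]
    unfolding Y_def zero_le_mult_iff by (cases "X \<omega>" "X \<omega>'" rule: linorder_cases) auto
  have r0: "0 \<le> r p" if "p \<in> space (M \<Otimes>\<^sub>M M)" for p
    unfolding r_def using coY that by (intro div0) (auto simp: space_pair_measure)
  have neX: "AE p in M \<Otimes>\<^sub>M M. X (fst p) \<noteq> X (snd p)"
    by (rule gibbs_energy_finite_imp(3)[OF M X _ c growth free_gibbs_measure_energy_less_top[OF gibbs]]) simp
  have neS: "AE p in M \<Otimes>\<^sub>M M. S (fst p) \<noteq> S (snd p)"
    by (rule AE_pair_neq_of_semicircular[OF M S law])
  have ai: "integrable (M \<Otimes>\<^sub>M M) a"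
  proof (rule Bochner_Integration.integrable_bound)
    show "integrable (M \<Otimes>\<^sub>M M) (\<lambda>p. (a p - 1)\<^sup>2 + 2)"
      by (intro Bochner_Integration.integrable_add fin P.integrable_const)
    have "\<bar>x\<bar> \<le> (x - 1)\<^sup>2 + 2" for x :: real
    proof -
      have "\<bar>x - 1\<bar> \<le> (x - 1)\<^sup>2 + 1"
        using zero_le_power2[of "\<bar>x - 1\<bar> - 1"] zero_le_power2[of "x - 1"]
        by (simp add: power2_diff)
      then show ?thesis by linarith
    qed
    then show "AE p in M \<Otimes>\<^sub>M M. norm (a p) \<le> norm ((a p - 1)\<^sup>2 + 2)" by simp
  qed simp
  have YSi: "integrable M (\<lambda>\<omega>. Y \<omega> * S \<omega>)"
  proof (rule integrable_const_bound[where B = "D * 2"])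
    show "AE \<omega> in M. norm (Y \<omega> * S \<omega>) \<le> D * 2"
      using YD AE_space by eventually_elim (auto simp: abs_mult intro!: mult_mono S2 D0)
  qed simp
  have YYi: "integrable M (\<lambda>\<omega>. Y \<omega> * Y \<omega>)"
  proof (rule integrable_const_bound[where B = "D * D"])
    show "AE \<omega> in M. norm (Y \<omega> * Y \<omega>) \<le> D * D"
      using YD by eventually_elim (unfold real_norm_def abs_mult, intro mult_mono, auto simp: D0)
  qed simp
  have SSi: "integrable M (\<lambda>\<omega>. (S \<omega>)\<^sup>2)"
  proof (rule integrable_const_bound[where B = "4"])
    show "AE \<omega> in M. norm ((S \<omega>)\<^sup>2) \<le> 4"
    proof (rule AE_I2)
      fix \<omega> assume "\<omega> \<in> space M"
      then have "(S \<omega>)\<^sup>2 \<le> 2\<^sup>2" using S2[of \<omega>] by (intro abs_le_square_iff[THEN iffD1]) auto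
      then show "norm ((S \<omega>)\<^sup>2) \<le> 4" by simp
    qed
  qed simp
  have SS: "(\<integral>\<omega>. (S \<omega>)\<^sup>2 \<partial>M) = 1"
    using integral_distr[OF S, of "\<lambda>x. x\<^sup>2"] integral_square_semicircular by (simp add: law)

  define Yn where "Yn n \<omega> = u' (truncation (real n) (X \<omega>))" for n \<omega>
  have [measurable]: "Yn n \<in> borel_measurable M" for n unfolding Yn_def by measurable
  have Ynb: "\<bar>Yn n \<omega>\<bar> \<le> \<bar>Y \<omega>\<bar> + \<bar>u' 0\<bar>" for n \<omega>
  proof (cases "0 \<le> X \<omega>")
    case True
    then have "u' 0 \<le> Yn n \<omega>" "Yn n \<omega> \<le> Y \<omega>"
      by (auto simp: Yn_def Y_def truncation_def intro!: monoD[OF mono])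
    then show ?thesis by linarith
  next
    case False
    then have "Y \<omega> \<le> Yn n \<omega>" "Yn n \<omega> \<le> u' 0"
      by (auto simp: Yn_def Y_def truncation_def intro!: monoD[OF mono])
    then show ?thesis by linarith
  qed
  have YYnb: "AE \<omega> in M. norm (Y \<omega> * Yn n \<omega>) \<le> D * (D + \<bar>u' 0\<bar>)" for n
    using YD
  proof eventually_elim
    case (elim \<omega>)
    then show ?case unfolding real_norm_def abs_mult
      using Ynb[of n \<omega>] D0 by (intro mult_mono) auto
  qed
  have YYni: "integrable M (\<lambda>\<omega>. Y \<omega> * Yn n \<omega>)" for n
    by (rule integrable_const_bound[OF YYnb]) simp
  have step: "integrable (M \<Otimes>\<^sub>M M) s \<and> (\<integral>p. s p \<partial>(M \<Otimes>\<^sub>M M))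
      \<le> (\<integral>\<omega>. Y \<omega> * S \<omega> \<partial>M) - (\<integral>\<omega>. Y \<omega> * Yn n \<omega> \<partial>M) + (\<integral>p. a p \<partial>(M \<Otimes>\<^sub>M M))" for n
  proof -
    define g where "g \<omega> = S \<omega> - Yn n \<omega>" for \<omega>
    have [measurable]: "g \<in> borel_measurable M" unfolding g_def by measurable
    obtain A where A: "0 \<le> A" and lipA: "\<And>x y. x \<in> {-real n..real n} \<Longrightarrow> y \<in> {-real n..real n} \<Longrightarrow>
        \<bar>u' x - u' y\<bar> \<le> A * \<bar>x - y\<bar>"
      using lip[of "real n"] by blast
    define K where "K = 2 + (\<bar>u' (- real n)\<bar> + \<bar>u' (real n)\<bar>)"
    have gK: "\<bar>g \<omega>\<bar> \<le> K" if "\<omega> \<in> space M" for \<omega>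
    proof -
      have "u' (- real n) \<le> Yn n \<omega>" "Yn n \<omega> \<le> u' (real n)"
        using truncation_range[of "real n" "X \<omega>"] by (auto simp: Yn_def intro!: monoD[OF mono])
      then show ?thesis using S2[OF that] unfolding g_def K_def by linarith
    qed
    have low: "- A * (X \<omega> - X \<omega>')\<^sup>2 \<le> (g \<omega> - g \<omega>') * (X \<omega> - X \<omega>')"
      if "\<omega> \<in> space M" "\<omega>' \<in> space M" for \<omega> \<omega>'
    proof -
      have "(Yn n \<omega> - Yn n \<omega>') * (X \<omega> - X \<omega>') \<le> \<bar>Yn n \<omega> - Yn n \<omega>'\<bar> * \<bar>X \<omega> - X \<omega>'\<bar>"
        unfolding abs_mult[symmetric] by (rule abs_ge_self)
      also have "\<bar>Yn n \<omega> - Yn n \<omega>'\<bar> \<le> A * \<bar>truncation n (X \<omega>) - truncation n (X \<omega>')\<bar>"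
        unfolding Yn_def by (intro lipA truncation_range) auto
      also have "\<dots> \<le> A * \<bar>X \<omega> - X \<omega>'\<bar>"
        using A by (intro mult_left_mono) (auto simp: truncation_def)
      finally have "(Yn n \<omega> - Yn n \<omega>') * (X \<omega> - X \<omega>') \<le> A * (X \<omega> - X \<omega>')\<^sup>2"
        by (simp add: power2_eq_square mult_right_mono mult.assoc)
      then show ?thesis using co[OF that] unfolding g_def by (simp add: algebra_simps)
    qed
    obtain B where B: "AE \<omega> in M. \<forall>\<theta>. \<bar>\<theta>\<bar> \<le> K \<longrightarrow> \<bar>u' (X \<omega> + \<theta>)\<bar> \<le> B"
      by (rule mono_shift_bounded[OF mono Yb])
    define z where "z p = (g (fst p) - g (snd p)) / (X (fst p) - X (snd p))" for p
    have zi: "integrable (M \<Otimes>\<^sub>M M) z" and zle: "(\<integral>p. z p \<partial>(M \<Otimes>\<^sub>M M)) \<le> (\<integral>\<omega>. u' (X \<omega>) * g \<omega> \<partial>M)"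
      using gibbs_first_variation[OF M X _ gibbs c growth der _ tangent gK A low B]
      unfolding z_def[abs_def] by auto
    define an where "an p = (Yn n (fst p) - Yn n (snd p)) / (X (fst p) - X (snd p))" for p
    have an: "0 \<le> an p" "an p \<le> a p" for p
      using truncated_slope_bounds[OF mono] by (auto simp: an_def a_def Yn_def)
    have ani: "integrable (M \<Otimes>\<^sub>M M) an"
    proof (rule Bochner_Integration.integrable_bound[OF ai])
      show "AE p in M \<Otimes>\<^sub>M M. norm (an p) \<le> norm (a p)"
        using an by (intro AE_I2) (auto intro: order_trans[OF _ abs_ge_self])
    qed (unfold an_def, measurable)
    have sz: "s = (\<lambda>p. z p + an p)"
      by (auto simp: s_def z_def an_def g_def add_divide_distrib[symmetric])
    have "integrable (M \<Otimes>\<^sub>M M) s" unfolding sz using zi ani by simp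
    moreover have "(\<integral>p. s p \<partial>(M \<Otimes>\<^sub>M M)) = (\<integral>p. z p \<partial>(M \<Otimes>\<^sub>M M)) + (\<integral>p. an p \<partial>(M \<Otimes>\<^sub>M M))"
      unfolding sz using zi ani by simp
    moreover have "(\<integral>p. an p \<partial>(M \<Otimes>\<^sub>M M)) \<le> (\<integral>p. a p \<partial>(M \<Otimes>\<^sub>M M))"
      by (intro integral_mono ani ai an)
    moreover have "(\<integral>\<omega>. u' (X \<omega>) * g \<omega> \<partial>M) = (\<integral>\<omega>. Y \<omega> * S \<omega> \<partial>M) - (\<integral>\<omega>. Y \<omega> * Yn n \<omega> \<partial>M)"
      unfolding g_def Y_def[symmetric] right_diff_distrib
      by (rule Bochner_Integration.integral_diff[OF YSi YYni])
    ultimately show ?thesis using zle by linarith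
  qed
  have si: "integrable (M \<Otimes>\<^sub>M M) s" using step by blast
  have lim: "(\<lambda>n. \<integral>\<omega>. Y \<omega> * Yn n \<omega> \<partial>M) \<longlonglongrightarrow> (\<integral>\<omega>. Y \<omega> * Y \<omega> \<partial>M)"
  proof (rule integral_dominated_convergence[where w = "\<lambda>_. D * (D + \<bar>u' 0\<bar>)"])
    show "AE \<omega> in M. (\<lambda>n. Y \<omega> * Yn n \<omega>) \<longlonglongrightarrow> Y \<omega> * Y \<omega>"
    proof (rule AE_I2)
      fix \<omega>
      obtain N where N: "\<bar>X \<omega>\<bar> \<le> real N" using real_arch_simple by blast
      have "\<forall>\<^sub>F n in sequentially. Y \<omega> * Yn n \<omega> = Y \<omega> * Y \<omega>"
        using eventually_ge_at_top[of N]
      proof eventually_elim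
        case (elim n)
        with N have "truncation (real n) (X \<omega>) = X \<omega>" by (auto simp: truncation_def)
        then show ?case by (simp add: Yn_def Y_def)
      qed
      then show "(\<lambda>n. Y \<omega> * Yn n \<omega>) \<longlonglongrightarrow> Y \<omega> * Y \<omega>" by (rule tendsto_eventually)
    qed
  qed (use YYnb in auto)
  have s_le: "(\<integral>p. s p \<partial>(M \<Otimes>\<^sub>M M))
      \<le> (\<integral>\<omega>. Y \<omega> * S \<omega> \<partial>M) - (\<integral>\<omega>. Y \<omega> * Y \<omega> \<partial>M) + (\<integral>p. a p \<partial>(M \<Otimes>\<^sub>M M))"
    using step by (intro LIMSEQ_le_const[OF tendsto_add[OF tendsto_diff[OF tendsto_const lim] tendsto_const]]) auto
  have ri: "integrable (M \<Otimes>\<^sub>M M) r"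
    and r_le: "(\<integral>p. r p \<partial>(M \<Otimes>\<^sub>M M)) \<le> (\<integral>\<omega>. S \<omega> * Y \<omega> \<partial>M)"
    using semicircular_stein_inequality[OF M S law _ S2 YD coY] unfolding r_def[abs_def] by auto
  have sq: "(u' (X \<omega>) - S \<omega>)\<^sup>2 = Y \<omega> * Y \<omega> - 2 * (Y \<omega> * S \<omega>) + (S \<omega>)\<^sup>2" for \<omega>
    by (simp add: Y_def power2_eq_square algebra_simps)
  show "integrable M (\<lambda>\<omega>. (u' (X \<omega>) - S \<omega>)\<^sup>2)"
    unfolding sq by (intro Bochner_Integration.integrable_add Bochner_Integration.integrable_diff
        integrable_mult_right YYi YSi SSi)
  have "(\<integral>\<omega>. (u' (X \<omega>) - S \<omega>)\<^sup>2 \<partial>M) = (\<integral>\<omega>. Y \<omega> * Y \<omega> \<partial>M) - 2 * (\<integral>\<omega>. Y \<omega> * S \<omega> \<partial>M) + 1"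
    unfolding sq using YYi YSi SSi by (simp add: SS)
  also have "\<dots> \<le> (\<integral>p. a p \<partial>(M \<Otimes>\<^sub>M M)) - (\<integral>p. s p \<partial>(M \<Otimes>\<^sub>M M)) - (\<integral>p. r p \<partial>(M \<Otimes>\<^sub>M M)) + 1"
    using s_le r_le by (simp add: mult.commute)
  also have "\<dots> = (\<integral>p. a p - s p - r p + 1 \<partial>(M \<Otimes>\<^sub>M M))"
    using ai si ri by (simp add: P.prob_space)
  also have "\<dots> \<le> (\<integral>p. (a p - 1)\<^sup>2 \<partial>(M \<Otimes>\<^sub>M M))"
  proof (rule integral_mono_AE[OF _ fin])
    show "integrable (M \<Otimes>\<^sub>M M) (\<lambda>p. a p - s p - r p + 1)"
      using ai si ri by simp
    show "AE p in M \<Otimes>\<^sub>M M. a p - s p - r p + 1 \<le> (a p - 1)\<^sup>2"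
      using neX neS AE_space
    proof eventually_elim
      case (elim p)
      have "a p = r p * s p" using elim by (simp add: a_def r_def s_def Y_def)
      then show ?case using slope_product_inequality[OF r0 s0, of p p] elim by simp
    qed
  qed
  finally show "(\<integral>\<omega>. (u' (X \<omega>) - S \<omega>)\<^sup>2 \<partial>M) \<le> (\<integral>p. (a p - 1)\<^sup>2 \<partial>(M \<Otimes>\<^sub>M M))" .
qed

lemma W2_squared: "(W2 \<mu> \<nu>)\<^sup>2 = transport_cost \<mu> \<nu>"
proof (cases "transport_cost \<mu> \<nu> = \<infinity>")
  case False
  then show ?thesis
    by (simp add: W2_def ennreal_power less_top[symmetric])
qed (simp add: W2_def)

lemma W2_squared_le:
  fixes Y S :: "'a \<Rightarrow> real"
  assumes M: "prob_space M" and Y [measurable]: "Y \<in> borel_measurable M"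
    and S [measurable]: "S \<in> borel_measurable M"
  shows "(W2 (distr M borel Y) (distr M borel S))\<^sup>2 \<le> (\<integral>\<^sup>+\<omega>. ennreal ((Y \<omega> - S \<omega>)\<^sup>2) \<partial>M)"
proof -
  let ?\<pi> = "distr M (borel \<Otimes>\<^sub>M borel) (\<lambda>\<omega>. (Y \<omega>, S \<omega>))"
  have "?\<pi> \<in> couplings (distr M borel Y) (distr M borel S)"
    using prob_space.prob_space_distr[OF M, of "\<lambda>\<omega>. (Y \<omega>, S \<omega>)" "borel \<Otimes>\<^sub>M borel"]
    by (auto simp: couplings_def distr_distr comp_def)
  then have "transport_cost (distr M borel Y) (distr M borel S)
      \<le> (\<integral>\<^sup>+(x, y). ennreal ((x - y)\<^sup>2) \<partial>?\<pi>)"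
    unfolding transport_cost_def by (rule INF_lower)
  also have "\<dots> = (\<integral>\<^sup>+\<omega>. ennreal ((Y \<omega> - S \<omega>)\<^sup>2) \<partial>M)"
    by (subst nn_integral_distr) auto
  finally show ?thesis by (simp add: W2_squared)
qed

text \<open>
The quantile functions of both measures, on the unit interval with Lebesgue measure, are a
comonotone pair.
\<close>

lemma quantile_comonotone:
  assumes "real_distribution \<nu>" "real_distribution \<rho>"
  obtains M :: "real measure" and X S where
    "prob_space M" "X \<in> borel_measurable M" "S \<in> borel_measurable M"
    "distr M borel X = \<nu>" "distr M borel S = \<rho>"
    "\<And>\<omega> \<omega>'. \<omega> \<in> space M \<Longrightarrow> \<omega>' \<in> space M \<Longrightarrow> 0 \<le> (X \<omega> - X \<omega>') * (S \<omega> - S \<omega>')"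
    "\<And>a b \<omega>. \<omega> \<in> space M \<Longrightarrow> (AE x in \<rho>. x \<in> {a..b}) \<Longrightarrow> S \<omega> \<in> {a..b}"
proof -
  interpret N: cdf_distribution \<nu> unfolding cdf_distribution_def by fact
  interpret R: cdf_distribution \<rho> unfolding cdf_distribution_def by fact
  let ?M = "restrict_space lborel {0<..<1} :: real measure"
  have sets: "sets ?M = sets (restrict_space borel {0<..<1})" by (simp add: sets_restrict_space)
  have sp: "space ?M = {0<..<1}" by (simp add: space_restrict_space)
  show thesis
  proof (rule that[of ?M N.I R.I])
    show "prob_space ?M"
      by (auto simp: space_restrict_space emeasure_restrict_space intro!: prob_spaceI)
    show "N.I \<in> borel_measurable ?M" "R.I \<in> borel_measurable ?M"
      using N.measurable_CI R.measurable_CI by (auto simp: measurable_cong_sets[OF sets refl])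
    show "distr ?M borel N.I = \<nu>" "distr ?M borel R.I = \<rho>"
      by (rule N.distr_I_eq_M R.distr_I_eq_M)+
  next
    fix \<omega> \<omega>' assume w: "\<omega> \<in> space ?M" "\<omega>' \<in> space ?M"
    show "0 \<le> (N.I \<omega> - N.I \<omega>') * (R.I \<omega> - R.I \<omega>')"
    proof (cases "\<omega> \<le> \<omega>'")
      case True
      then have "N.I \<omega> \<le> N.I \<omega>'" "R.I \<omega> \<le> R.I \<omega>'"
        using w unfolding sp by (auto intro: mono_onD[OF N.mono_I] mono_onD[OF R.mono_I])
      then show ?thesis by (simp add: zero_le_mult_iff)
    next
      case False
      then have "N.I \<omega>' \<le> N.I \<omega>" "R.I \<omega>' \<le> R.I \<omega>"
        using w unfolding sp by (auto intro: mono_onD[OF N.mono_I] mono_onD[OF R.mono_I])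
      then show ?thesis by (simp add: zero_le_mult_iff)
    qed
  next
    fix a b \<omega> assume w: "\<omega> \<in> space ?M" and ae: "AE x in \<rho>. x \<in> {a..b}"
    have "R.C b = 1"
      unfolding cdf_def using ae by (subst R.prob_eq_1) (auto elim: eventually_mono)
    then have up: "R.I \<omega> \<le> b" using w R.pseudoinverse[of \<omega> b] by (simp add: sp)
    have "\<not> R.I \<omega> \<le> x" if "x < a" for x
    proof -
      have "R.C x = 0"
        unfolding cdf_def using ae that by (subst R.prob_eq_0) (auto elim: eventually_mono)
      then show ?thesis using w R.pseudoinverse[of \<omega> x] by (simp add: sp)
    qed
    then have "a \<le> R.I \<omega>" by (meson not_less order_refl)
    with up show "R.I \<omega> \<in> {a..b}" by simp
  qed
qed

text \<open>
The range of f is an interval, hence a Borel set, and the inverse extends by 0 outside it.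
\<close>

lemma strict_mono_left_inverse_measurable:
  fixes f :: "real \<Rightarrow> real"
  assumes mono: "strict_mono f" and cont: "continuous_on UNIV f"
  obtains h where "h \<in> borel_measurable borel" "\<And>x. h (f x) = x"
proof
  let ?h = "\<lambda>y. indicator (range f) y * the_inv f y"
  have inj: "inj f" by (rule strict_mono_imp_inj_on[OF mono])
  have "is_interval (range f)"
    unfolding is_interval_connected_1 using cont by (intro connected_continuous_image) auto
  then have R: "range f \<in> sets borel" by (rule real_interval_borel_measurable)
  have "mono_on (range f) (the_inv f)"
    using mono by (auto intro!: mono_onI simp: the_inv_f_f[OF inj] strict_mono_less_eq)
  then have "the_inv f \<in> borel_measurable (restrict_space borel (range f))"
    by (rule borel_measurable_mono_on_fnc)
  then show "?h \<in> borel_measurable borel"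
    using R by (subst (asm) borel_measurable_restrict_space_iff) (auto simp: mult.commute)
  show "?h (f x) = x" for x by (simp add: the_inv_f_f[OF inj])
qed

section \<open>Transport of the free Gibbs measure\<close>

text \<open>
A centered measure of constant sign is the point mass at 0, which is not absolutely
continuous. Applied to u', this makes u grow linearly at both ends.
\<close>

lemma centered_takes_both_signs:
  fixes f :: "real \<Rightarrow> real"
  assumes \<mu>: "prob_space \<mu>" "sets \<mu> = sets borel" and cent: "centered \<mu>"
    and ac: "absolutely_continuous lborel \<mu>" and range: "AE y in \<mu>. y \<in> range f"
  obtains p q where "f p < 0" "0 < f q"
proof -
  interpret prob_space \<mu> by fact
  note \<mu>(2)[measurable_cong]
  have "{0::real} \<in> null_sets lborel" by (intro null_setsI) auto
  then have "{0} \<in> null_sets \<mu>" using ac by (auto simp: absolutely_continuous_def)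
  then have ne: "AE y in \<mu>. y \<noteq> 0" by (auto dest: AE_not_in)
  have int: "integrable \<mu> (\<lambda>y. y)" "(\<integral>y. y \<partial>\<mu>) = 0"
    using cent by (auto simp: centered_def)
  have pos: "\<not> (AE y in \<mu>. 0 \<le> y)"
  proof
    assume "AE y in \<mu>. 0 \<le> y"
    then have "AE y in \<mu>. y = 0"
      using integral_nonneg_eq_0_iff_AE[OF int(1)] int(2) by simp
    with ne have "AE y in \<mu>. False" by eventually_elim auto
    then show False by simp
  qed
  have neg: "\<not> (AE y in \<mu>. 0 \<le> - y)"
  proof
    assume "AE y in \<mu>. 0 \<le> - y"
    then have "AE y in \<mu>. - y = 0"
      using integral_nonneg_eq_0_iff_AE[OF integrable_minus[OF int(1)]] int(2) by simp
    with ne have "AE y in \<mu>. False" by eventually_elim auto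
    then show False by simp
  qed
  have "\<exists>p. f p < 0"
  proof (rule ccontr)
    assume "\<not> ?thesis"
    then have "AE y in \<mu>. 0 \<le> y" using range by (auto elim!: eventually_mono simp: not_less)
    with pos show False ..
  qed
  moreover have "\<exists>q. 0 < f q"
  proof (rule ccontr)
    assume "\<not> ?thesis"
    then have "AE y in \<mu>. 0 \<le> - y" using range by (auto elim!: eventually_mono simp: not_less)
    with neg show False ..
  qed
  ultimately show thesis using that by blast
qed

theorem corollary1:
  fixes \<mu> \<nu> :: "real measure" and u :: "real \<Rightarrow> real"
  assumes "borel_prob \<mu>"
    and "centered \<mu>"
    and "absolutely_continuous lborel \<mu>"
    and "\<exists>a b. AE x in \<mu>. x \<in> {a..b}"
    and "free_moment_map \<mu> u"
    and "free_gibbs_measure u \<nu>"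
    and "C2_real u"
    and "strictly_convex u"
  shows "(W2 \<mu> semicircular)\<^sup>2 \<le>
           (\<integral>\<^sup>+(x, y). ennreal (((x - y) / (legendre_deriv u x - legendre_deriv u y) - 1)\<^sup>2)
              \<partial>(\<mu> \<Otimes>\<^sub>M \<mu>))
         \<and> (\<integral>\<^sup>+(x, y). ennreal (((x - y) / (legendre_deriv u x - legendre_deriv u y) - 1)\<^sup>2)
              \<partial>(\<mu> \<Otimes>\<^sub>M \<mu>)) =
           (\<integral>\<^sup>+(x, y). ennreal (((deriv u x - deriv u y) / (x - y) - 1)\<^sup>2) \<partial>(\<nu> \<Otimes>\<^sub>M \<nu>))"
proof -
  let ?u' = "deriv u"
  note der = C2_real_DERIV[OF \<open>C2_real u\<close>]
  note cont = C2_real_continuous_deriv[OF \<open>C2_real u\<close>]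
  note tangent = strictly_convex_above_tangent(1)[OF \<open>strictly_convex u\<close> der]
  have smono: "strict_mono ?u'"
    by (rule strictly_convex_strict_mono_deriv[OF \<open>strictly_convex u\<close> der])
  then have mono: "mono ?u'" by (rule strict_mono_mono)
  have u'm [measurable]: "?u' \<in> borel_measurable borel" by (rule borel_measurable_mono[OF mono])
  have \<mu>p: "prob_space \<mu>" and \<mu>s [measurable_cong]: "sets \<mu> = sets borel"
    using \<open>borel_prob \<mu>\<close> by (auto simp: borel_prob_def)
  have "borel_prob \<nu>"
    using \<open>free_gibbs_measure u \<nu>\<close> by (auto simp: free_gibbs_measure_def is_arg_min_def)
  then have \<nu>p: "prob_space \<nu>" and \<nu>s [measurable_cong]: "sets \<nu> = sets borel"
    by (auto simp: borel_prob_def)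
  interpret prob_space \<nu> by (rule \<nu>p)
  have \<mu>_eq: "\<mu> = distr \<nu> borel ?u'"
    using \<open>free_moment_map \<mu> u\<close> \<open>free_gibbs_measure u \<nu>\<close>
    unfolding free_moment_map_def free_gibbs_measure_def by metis
  have u'\<nu>: "?u' \<in> measurable \<nu> borel" by measurable
  have range: "AE y in \<mu>. y \<in> range ?u'"
  proof -
    obtain h where h [measurable]: "h \<in> borel_measurable borel" and hu: "\<And>x. h (?u' x) = x"
      using strict_mono_left_inverse_measurable[OF smono cont] by blast
    have "AE y in \<mu>. ?u' (h y) = y"
      unfolding \<mu>_eq by (subst AE_distr_iff[OF u'\<nu>]) (auto simp: hu)
    then show ?thesis by eventually_elim (metis rangeI)
  qed

  have pair: "\<mu> \<Otimes>\<^sub>M \<mu> = distr (\<nu> \<Otimes>\<^sub>M \<nu>) (borel \<Otimes>\<^sub>M borel) (\<lambda>(x, y). (?u' x, ?u' y))"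
    using prob_space_imp_sigma_finite[OF \<mu>p] unfolding \<mu>_eq
    by (intro pair_measure_distr u'\<nu>)
  have uu: "(\<lambda>(x, y). (?u' x, ?u' y)) \<in> measurable (\<nu> \<Otimes>\<^sub>M \<nu>) (borel \<Otimes>\<^sub>M borel)" by measurable
  \<comment> \<open>The Legendre derivative is known only on the range of u', so it is replaced almost everywhere
      by a measurable left inverse of u' before changing variables.\<close>
  have equality: "(\<integral>\<^sup>+(x, y). ennreal (((x - y) / (legendre_deriv u x - legendre_deriv u y) - 1)\<^sup>2) \<partial>(\<mu> \<Otimes>\<^sub>M \<mu>))
      = (\<integral>\<^sup>+(x, y). ennreal (((?u' x - ?u' y) / (x - y) - 1)\<^sup>2) \<partial>(\<nu> \<Otimes>\<^sub>M \<nu>))"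
  proof -
    obtain h where h [measurable]: "h \<in> borel_measurable borel" and hu: "\<And>x. h (?u' x) = x"
      using strict_mono_left_inverse_measurable[OF smono cont] by blast
    have leg: "AE y in \<mu>. legendre_deriv u y = h y"
      using range
    proof eventually_elim
      case (elim y)
      then show ?case using legendre_deriv_deriv[OF \<open>strictly_convex u\<close> der cont] hu by auto
    qed
    have "(\<integral>\<^sup>+(x, y). ennreal (((x - y) / (legendre_deriv u x - legendre_deriv u y) - 1)\<^sup>2) \<partial>(\<mu> \<Otimes>\<^sub>M \<mu>))
        = (\<integral>\<^sup>+(x, y). ennreal (((x - y) / (h x - h y) - 1)\<^sup>2) \<partial>(\<mu> \<Otimes>\<^sub>M \<mu>))"
    proof (rule nn_integral_cong_AE)
      show "AE p in \<mu> \<Otimes>\<^sub>M \<mu>.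
          (case p of (x, y) \<Rightarrow> ennreal (((x - y) / (legendre_deriv u x - legendre_deriv u y) - 1)\<^sup>2))
          = (case p of (x, y) \<Rightarrow> ennreal (((x - y) / (h x - h y) - 1)\<^sup>2))"
        using prob_space.AE_pair_fst[OF \<mu>p leg] prob_space.AE_pair_snd[OF \<mu>p leg]
        by eventually_elim (simp add: case_prod_beta')
    qed
    also have "\<dots> = (\<integral>\<^sup>+(x, y). ennreal (((?u' x - ?u' y) / (x - y) - 1)\<^sup>2) \<partial>(\<nu> \<Otimes>\<^sub>M \<nu>))"
      unfolding pair by (subst nn_integral_distr[OF uu]) (auto simp: hu case_prod_beta')
    finally show ?thesis .
  qed

  obtain p q where pq: "?u' p < 0" "0 < ?u' q"
    by (rule centered_takes_both_signs[OF \<mu>p \<mu>s \<open>centered \<mu>\<close> \<open>absolutely_continuous lborel \<mu>\<close> range])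
  obtain c C where c: "0 < c" and growth: "\<And>x. c * \<bar>x\<bar> - C \<le> u x"
    using convex_linear_growth[OF tangent pq] by blast
  have "real_distribution \<nu>" "real_distribution semicircular"
    using \<nu>p \<nu>s prob_space_semicircular
    by (auto simp: real_distribution_def real_distribution_axioms_def)
  then obtain M :: "real measure" and X S where M: "prob_space M"
    and X [measurable]: "X \<in> borel_measurable M" and S [measurable]: "S \<in> borel_measurable M"
    and lawX: "distr M borel X = \<nu>" and lawS: "distr M borel S = semicircular"
    and co: "\<And>\<omega> \<omega>'. \<omega> \<in> space M \<Longrightarrow> \<omega>' \<in> space M \<Longrightarrow> 0 \<le> (X \<omega> - X \<omega>') * (S \<omega> - S \<omega>')"
    and S2': "\<And>a b \<omega>. \<omega> \<in> space M \<Longrightarrow> (AE x in semicircular. x \<in> {a..b}) \<Longrightarrow> S \<omega> \<in> {a..b}"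
    by (rule quantile_comonotone) blast
  have S2: "\<bar>S \<omega>\<bar> \<le> 2" if "\<omega> \<in> space M" for \<omega>
    using S2'[OF that AE_semicircular] by auto
  obtain D where "AE y in \<mu>. \<bar>y\<bar> \<le> D"
  proof -
    obtain a b where "AE x in \<mu>. x \<in> {a..b}" using assms(4) by blast
    then have "AE y in \<mu>. \<bar>y\<bar> \<le> max \<bar>a\<bar> \<bar>b\<bar>" by eventually_elim auto
    then show thesis by (rule that)
  qed
  then have "AE x in \<nu>. \<bar>?u' x\<bar> \<le> D"
    unfolding \<mu>_eq by (rule AE_distrD[OF u'\<nu>])
  then have Yb: "AE \<omega> in M. \<bar>?u' (X \<omega>)\<bar> \<le> D"
    unfolding lawX[symmetric] by (rule AE_distrD[OF X])
  define a where "a p = (?u' (X (fst p)) - ?u' (X (snd p))) / (X (fst p) - X (snd p))" for p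
  have [measurable]: "a \<in> borel_measurable (M \<Otimes>\<^sub>M M)" unfolding a_def by measurable
  have pairM: "\<nu> \<Otimes>\<^sub>M \<nu> = distr (M \<Otimes>\<^sub>M M) (borel \<Otimes>\<^sub>M borel) (\<lambda>(x, y). (X x, X y))"
    using sigma_finite_measure_axioms unfolding lawX[symmetric]
    by (intro pair_measure_distr X)
  have rhs: "(\<integral>\<^sup>+(x, y). ennreal (((?u' x - ?u' y) / (x - y) - 1)\<^sup>2) \<partial>(\<nu> \<Otimes>\<^sub>M \<nu>))
      = (\<integral>\<^sup>+p. ennreal ((a p - 1)\<^sup>2) \<partial>(M \<Otimes>\<^sub>M M))"
    unfolding pairM by (subst nn_integral_distr) (auto simp: a_def case_prod_beta')
  have "(W2 \<mu> semicircular)\<^sup>2 \<le> (\<integral>\<^sup>+p. ennreal ((a p - 1)\<^sup>2) \<partial>(M \<Otimes>\<^sub>M M))"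

  proof (cases "(\<integral>\<^sup>+p. ennreal ((a p - 1)\<^sup>2) \<partial>(M \<Otimes>\<^sub>M M)) = \<infinity>")
    case False
    then have fin: "integrable (M \<Otimes>\<^sub>M M) (\<lambda>p. (a p - 1)\<^sup>2)"
      by (intro integrableI_nonneg) (auto simp: top.not_eq_extremum)
    have gibbs: "free_gibbs_measure u (distr M borel X)"
      unfolding lawX by fact
    have bound: "integrable M (\<lambda>\<omega>. (?u' (X \<omega>) - S \<omega>)\<^sup>2)"
      "(\<integral>\<omega>. (?u' (X \<omega>) - S \<omega>)\<^sup>2 \<partial>M) \<le> (\<integral>p. (a p - 1)\<^sup>2 \<partial>(M \<Otimes>\<^sub>M M))"
      using gibbs_monotone_coupling[OF M X S lawS S2 co gibbs c growth der mono
          C2_real_deriv_lipschitz[OF \<open>C2_real u\<close>] tangent Yb] fin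
      unfolding a_def by auto
    have law\<mu>: "distr M borel (\<lambda>\<omega>. ?u' (X \<omega>)) = \<mu>"
      unfolding \<mu>_eq lawX[symmetric] by (subst distr_distr) (auto simp: comp_def)
    have "(W2 \<mu> semicircular)\<^sup>2 \<le> (\<integral>\<^sup>+\<omega>. ennreal ((?u' (X \<omega>) - S \<omega>)\<^sup>2) \<partial>M)"
      using W2_squared_le[OF M _ S, of "\<lambda>\<omega>. ?u' (X \<omega>)"] by (simp add: law\<mu> lawS)
    also have "\<dots> = ennreal (\<integral>\<omega>. (?u' (X \<omega>) - S \<omega>)\<^sup>2 \<partial>M)"
      by (intro nn_integral_eq_integral bound) auto
    also have "\<dots> \<le> ennreal (\<integral>p. (a p - 1)\<^sup>2 \<partial>(M \<Otimes>\<^sub>M M))"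
      by (intro ennreal_leI bound)
    also have "\<dots> = (\<integral>\<^sup>+p. ennreal ((a p - 1)\<^sup>2) \<partial>(M \<Otimes>\<^sub>M M))"
      by (intro nn_integral_eq_integral[symmetric] fin) auto
    finally show ?thesis .
  qed simp
  then show ?thesis unfolding equality rhs by simp
qed

end
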